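(* Let $A:X\to Y$ be an injective bounded linear operator with non-closed range between two Hilbert spaces $X$ and $Y$. Let the variable Hilbert scale $\{X_\nu\}$ ($\nu$ ranging over the index functions), with norms $\|\cdot\|_\nu$, be generated by $T=(A^*A)^{-1}$. Let $\chi$ and $\Psi$ be index functions, with $\Psi$ concave, such that $$\Psi\left(\chi(\lambda)\,\lambda\right)\ge\lambda\qquad\text{for all } \|T^{-1}\|^{-1}\le\lambda<\infty .$$ Let $f\in X$ be the solution of $Af=g$, where $g\in Y$. If $f\in X_\chi$ and if $f_\alpha\in X_\chi$ is such that $$\|f_\alpha-f\|_\chi=\zeta>0,\qquad \|Af_\alpha-g\|=\epsilon>0,$$ then $$\|f-f_\alpha\|\le\epsilon\sqrt{\Psi(\zeta^2/\epsilon^2)} .$$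
   Context: $X$ and $Y$ are infinite dimensional separable Hilbert spaces, with norms denoted $\|\cdot\|$. An index function is a continuous function $(0,\infty)\to(0,\infty)$. For an injective self-adjoint positive definite operator $T$ densely defined on $X$ and an index function $\nu$, the space $X_\nu$ of the variable Hilbert scale generated by $T$ is the closure (completion) of the domain of the quadratic form $\|h\|_\nu^2=(h,\nu(T)h)$, with norm $\|\cdot\|_\nu$, where $\nu(T)$ is defined by the spectral calculus. The element $f_\alpha$ plays the role of an approximation of $f$ obtained by some regularisation method with parameter $\alpha>0$. *)

theory Defs
  imports "HOL-Analysis.Analysis"
begin

definition index_function :: "(real \<Rightarrow> real) \<Rightarrow> bool" where
  "index_function \<nu> \<longleftrightarrow> continuous_on {0<..} \<nu> \<and> (\<forall>x>0. \<nu> x > 0)"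

definition infinite_dimensional :: "'a::real_vector itself \<Rightarrow> bool" where
  "infinite_dimensional _ \<longleftrightarrow> (\<nexists>B::'a set. finite B \<and> span B = UNIV)"


section \<open>Spectral calculus for unbounded self-adjoint operators\<close>

text \<open>
  Unbounded, densely defined operators are represented by their graphs, as sets of pairs;
  the domain of definition is then \<^const>\<open>Domain\<close>.
\<close>

type_synonym 'a unbounded_op = "('a \<times> 'a) set"

definition projection_valued_measure :: "(real set \<Rightarrow> 'a::real_inner \<Rightarrow> 'a) \<Rightarrow> bool" where
  "projection_valued_measure E \<longleftrightarrow>
     (\<forall>S\<in>sets borel. bounded_linear (E S) \<and> (\<forall>x y. E S x \<bullet> y = x \<bullet> E S y)) \<and>
     (\<forall>S\<in>sets borel. \<forall>S'\<in>sets borel. \<forall>x. E (S \<inter> S') x = E S (E S' x)) \<and>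
     (\<forall>x. E UNIV x = x) \<and>
     (\<forall>F::nat \<Rightarrow> real set. range F \<subseteq> sets borel \<longrightarrow> disjoint_family F \<longrightarrow>
        (\<forall>x. (\<lambda>n. E (F n) x) sums E (\<Union>n. F n) x))"

definition scalar_measure :: "(real set \<Rightarrow> 'a::real_inner \<Rightarrow> 'a) \<Rightarrow> 'a \<Rightarrow> real measure" where
  "scalar_measure E h = measure_of UNIV (sets borel) (\<lambda>S. ennreal (h \<bullet> E S h))"

text \<open>
  The operator \<open>\<integral>\<phi> dE\<close> for a real Borel function \<open>\<phi>\<close>.  Its domain consists of those \<open>h\<close> for
  which \<open>\<phi>\<close> is square integrable with respect to \<open>\<mu>\<^sub>h = (h, E(\<cdot>) h)\<close>, and its value \<open>k\<close> is
  determined by \<open>(k, u) = \<integral>\<phi> d(E(\<cdot>) h, u)\<close> for all \<open>u\<close> in the (dense) domain; the signed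
  measure \<open>(E(\<cdot>) h, u)\<close> is \<open>(\<mu>\<^bsub>h+u\<^esub> - \<mu>\<^bsub>h-u\<^esub>) / 4\<close> by polarisation.
\<close>

definition spectral_integral ::
  "(real set \<Rightarrow> 'a::real_inner \<Rightarrow> 'a) \<Rightarrow> (real \<Rightarrow> real) \<Rightarrow> 'a unbounded_op" where
  "spectral_integral E \<phi> =
     {(h, k). integrable (scalar_measure E h) (\<lambda>x. (\<phi> x)\<^sup>2) \<and>
        (\<forall>u. integrable (scalar_measure E u) (\<lambda>x. (\<phi> x)\<^sup>2) \<longrightarrow>
           k \<bullet> u = ((\<integral>x. \<phi> x \<partial>scalar_measure E (h + u)) -
                    (\<integral>x. \<phi> x \<partial>scalar_measure E (h - u))) / 4)}"

text \<open>For self-adjoint \<open>T\<close> the spectral measure exists and is unique on Borel sets.\<close>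

definition spectral_measure ::
  "'a::real_inner unbounded_op \<Rightarrow> (real set \<Rightarrow> 'a \<Rightarrow> 'a)" where
  "spectral_measure T =
     (SOME E. projection_valued_measure E \<and> T = spectral_integral E (\<lambda>x. x))"

text \<open>
  The operator \<open>\<nu>(T)\<close> for injective positive \<open>T\<close>.  The spectral measure of such a \<open>T\<close> is
  concentrated on \<open>(0,\<infinity>)\<close>, and \<open>\<nu>\<close> only matters there: the values that an index function,
  being a total function in HOL, takes outside \<open>(0,\<infinity>)\<close> are discarded.
\<close>

definition spectral_calculus ::
  "'a::real_inner unbounded_op \<Rightarrow> (real \<Rightarrow> real) \<Rightarrow> 'a unbounded_op" where
  "spectral_calculus T \<nu> =
     spectral_integral (spectral_measure T) (\<lambda>x. if x > 0 then \<nu> x else 0)"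


section \<open>Variable Hilbert scales\<close>

definition quadratic_form :: "'a::real_inner unbounded_op \<Rightarrow> 'a \<Rightarrow> real" where
  "quadratic_form N h = h \<bullet> (SOME k. (h, k) \<in> N)"

definition form_norm :: "'a::real_inner unbounded_op \<Rightarrow> (real \<Rightarrow> real) \<Rightarrow> 'a \<Rightarrow> real" where
  "form_norm T \<nu> h = sqrt (quadratic_form (spectral_calculus T \<nu>) h)"

text \<open>
  \<open>X\<^sub>\<nu>\<close> is the completion of the domain of the form under \<^const>\<open>form_norm\<close>.  An element \<open>h\<close> of
  \<open>X\<close> is identified with an element of the completion if it is the limit in \<open>X\<close> of a sequence
  in the domain that is Cauchy for \<^const>\<open>form_norm\<close>, and its norm is then the limit of the norms.
  The form is closable, so this does not depend on the sequence.  If \<open>\<nu>\<close> is bounded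
  away from \<open>0\<close> on the spectrum of \<open>T\<close>, every element of the completion arises in this way;
  otherwise \<open>hilbert_scale T \<nu>\<close> is \<open>X \<inter> X\<^sub>\<nu>\<close>.
\<close>

definition represents ::
  "'a::real_inner unbounded_op \<Rightarrow> (real \<Rightarrow> real) \<Rightarrow> (nat \<Rightarrow> 'a) \<Rightarrow> 'a \<Rightarrow> bool" where
  "represents T \<nu> s h \<longleftrightarrow>
     (\<forall>n. s n \<in> Domain (spectral_calculus T \<nu>)) \<and>
     (\<forall>e>0. \<exists>N. \<forall>m\<ge>N. \<forall>n\<ge>N. form_norm T \<nu> (s m - s n) < e) \<and>
     s \<longlonglongrightarrow> h"

definition hilbert_scale ::
  "'a::real_inner unbounded_op \<Rightarrow> (real \<Rightarrow> real) \<Rightarrow> 'a set" where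
  "hilbert_scale T \<nu> = {h. \<exists>s. represents T \<nu> s h}"

definition scale_norm ::
  "'a::real_inner unbounded_op \<Rightarrow> (real \<Rightarrow> real) \<Rightarrow> 'a \<Rightarrow> real" where
  "scale_norm T \<nu> h = lim (\<lambda>n. form_norm T \<nu> ((SOME s. represents T \<nu> s h) n))"

text \<open>
  \<open>(A\<^sup>*A)\<^sup>-\<^sup>1\<close>, with domain the range of \<open>A\<^sup>*A\<close>; it is single-valued when \<open>A\<close> is injective.
\<close>

definition gram :: "('a::real_inner \<Rightarrow> 'b::real_inner) \<Rightarrow> 'a \<Rightarrow> 'a" where
  "gram A = adjoint A \<circ> A"

definition gram_inverse :: "('a::real_inner \<Rightarrow> 'b::real_inner) \<Rightarrow> 'a unbounded_op" where
  "gram_inverse A = {(gram A x, x) | x. True}"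

end

theory Submission
  imports Defs "HOL-Probability.Helly_Selection"
begin

text \<open>
  Let \<open>B = A\<^sup>*A\<close>, let \<open>E\<close> be the spectral measure of \<open>T = B\<^sup>-\<^sup>1\<close> and \<open>\<mu>\<^sub>h = (h, E(\<cdot>) h)\<close>.
  Then \<open>\<mu>\<^sub>h\<close> lives on \<open>[1/\<parallel>B\<parallel>, \<infinity>)\<close>, \<open>\<parallel>h\<parallel>\<^sup>2 = \<integral> 1 d\<mu>\<^sub>h\<close>, \<open>\<parallel>A h\<parallel>\<^sup>2 = \<integral> 1/t d\<mu>\<^sub>h\<close> and
  \<open>\<parallel>h\<parallel>\<^sub>\<chi>\<^sup>2 = \<integral> \<chi> d\<mu>\<^sub>h\<close>, so the claim is Jensen's inequality for the measure \<open>(1/t) d\<mu>\<^sub>h\<close> when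
  \<open>h\<close> is in the domain of \<open>\<chi>(T)\<close>; continuity of \<open>\<Psi>\<close> extends it to \<open>X\<^sub>\<chi>\<close>.

  The existence of \<open>E\<close> is the spectral theorem. Since \<open>B\<^sup>i (1 - B)\<^sup>j\<close> is positive for \<open>0 \<le> B \<le> 1\<close>,
  the numbers \<open>(B\<^sup>k x, x)\<close> are the moments of a measure; polarising these measures in \<open>x\<close> gives a
  functional calculus for bounded Borel functions, in which \<open>E(S)\<close> is the value at the indicator
  function of \<open>{t. 1/t \<in> S}\<close>.
\<close>

section \<open>Riesz representation\<close>

text \<open>Choices by \<open>SOME\<close> shape the proof. \<open>spectral_measure\<close> is some
  resolution of \<open>T\<close>, so the constructed one only shows that the choice meets its
  specification; the support and the integral formulas are then derived for any resolution with the
  right graph (\<open>inverse_resolution\<close>). \<open>scale_norm\<close> is a limit along some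
  representing sequence, so the estimate is proved along the very sequence chosen.

  The moment measure of each \<open>x\<close> is also picked separately. That it depends
  quadratically on \<open>x\<close>, and that the calculus is multiplicative, rests on determinacy:
  on a compact interval a signed measure with vanishing moments is zero, by Weierstrass
  approximation. Signed measures occur only as functionals on bounded Borel functions.

  The lower edge of the support comes from
  \<open>|B x|^2 \<le> \<parallel>B\<parallel> (B x, x)\<close>; it is exactly the point from which
  the hypothesis on \<open>\<Psi>\<close> and \<open>chi\<close> is available.\<close>

lemma norm_add_sub_squares:
  fixes x y :: "'a::real_inner"
  shows "(norm (x + y))\<^sup>2 + (norm (x - y))\<^sup>2 = 2 * (norm x)\<^sup>2 + 2 * (norm y)\<^sup>2"
  by (simp add: power2_norm_eq_inner inner_simps inner_commute)

text \<open>The representing vector minimises \<open>J x = |x|^2 - 2 f x\<close>: the parallelogram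
  law makes a minimising sequence Cauchy, and the vanishing first variation of \<open>J\<close> at
  its limit is the claim.\<close>

lemma riesz_representation:
  fixes f :: "'a::{real_inner, complete_space} \<Rightarrow> real"
  assumes "bounded_linear f"
  shows "\<exists>z. \<forall>y. f y = z \<bullet> y"
proof -
  interpret f: bounded_linear f by fact
  define J where "J x = (norm x)\<^sup>2 - 2 * f x" for x
  obtain K where K: "\<And>x. norm (f x) \<le> norm x * K"
    using f.bounded by blast
  \<comment> \<open>Completing the square: \<open>J x \<ge> (|x| - K)^2 - K^2\<close>.\<close>
  have J_ge: "- K\<^sup>2 \<le> J x" for x
  proof -
    have "f x \<le> norm x * K"
      using K[of x] by simp
    moreover have "0 \<le> (norm x - K)\<^sup>2"
      by simp
    ultimately show ?thesis
      by (simp add: J_def power2_diff)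
  qed
  define m where "m = (INF x. J x)"
  have bdd: "bdd_below (range J)"
    using J_ge by (intro bdd_belowI[of _ "- K\<^sup>2"]) auto
  have m_le: "m \<le> J x" for x
    unfolding m_def by (rule cINF_lower[OF bdd]) simp
  define r where "r n = inverse (real (Suc n))" for n
  have "\<exists>x. J x < m + r n" for n
    using cINF_less_iff[of UNIV J "m + r n"] bdd
    by (simp add: m_def[symmetric] r_def)
  then obtain s where s: "\<And>n. J (s n) < m + r n"
    by metis
  have mid: "(norm (x - y))\<^sup>2 \<le> 2 * (J x - m) + 2 * (J y - m)" for x y
  proof -
    have "m \<le> J ((1/2) *\<^sub>R (x + y))"
      by (rule m_le)
    then have "4 * m \<le> (norm (x + y))\<^sup>2 - 4 * f x - 4 * f y"
      by (simp add: J_def f.scaleR f.add power_mult_distrib power_divide add_divide_distrib del: scaleR_add_right)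
    then show ?thesis
      using norm_add_sub_squares[of x y] by (simp add: J_def)
  qed
  have "Cauchy s"
  proof (rule metric_CauchyI)
    fix e :: real assume "0 < e"
    then obtain N where N: "r N < e\<^sup>2 / 4"
      using reals_Archimedean[of "e\<^sup>2 / 4"] by (auto simp: r_def)
    show "\<exists>M. \<forall>m\<ge>M. \<forall>n\<ge>M. dist (s m) (s n) < e"
    proof (intro exI allI impI)
      fix i j assume ij: "N \<le> i" "N \<le> j"
      have "r i \<le> r N" "r j \<le> r N"
        using ij by (auto simp: r_def)
      then have "(norm (s i - s j))\<^sup>2 < e\<^sup>2"
        using mid[of "s i" "s j"] s[of i] s[of j] N by argo
      then show "dist (s i) (s j) < e"
        using \<open>0 < e\<close> by (simp add: dist_norm power2_less_imp_less)
    qed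
  qed
  then obtain z where z: "s \<longlonglongrightarrow> z"
    using Cauchy_convergent convergent_def by blast
  have "(\<lambda>n. J (s n)) \<longlonglongrightarrow> J z"
    unfolding J_def by (intro tendsto_intros z f.tendsto)
  moreover have "(\<lambda>n. m + r n) \<longlonglongrightarrow> m + 0"
    unfolding r_def by (intro tendsto_intros LIMSEQ_inverse_real_of_nat)
  ultimately have "J z \<le> m"
    using s by (intro LIMSEQ_le[of _ _ _ m]) (auto intro: less_imp_le)
  then have min: "J z \<le> J x" for x
    using m_le[of x] by linarith
  have "f y = z \<bullet> y" for y
  proof (rule ccontr)
    assume "f y \<noteq> z \<bullet> y"
    define d where "d = z \<bullet> y - f y"
    have d: "d \<noteq> 0" using \<open>f y \<noteq> z \<bullet> y\<close> by (simp add: d_def)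
    \<comment> \<open>Nearly the minimiser of \<open>2 t d + t^2 |y|^2\<close>; the added
      \<open>1\<close> keeps the denominator positive.\<close>
    define t where "t = - d / ((norm y)\<^sup>2 + 1)"
    have ny: "(norm y)\<^sup>2 + 1 > 0" by (simp add: add_nonneg_pos)
    have "(norm (z + t *\<^sub>R y))\<^sup>2 = (norm z)\<^sup>2 + 2 * t * (z \<bullet> y) + t\<^sup>2 * (norm y)\<^sup>2"
      unfolding power2_norm_eq_inner
      by (simp add: inner_simps inner_commute power2_eq_square algebra_simps)
    then have "J (z + t *\<^sub>R y) = J z + 2 * t * d + t\<^sup>2 * (norm y)\<^sup>2"
      by (simp add: J_def d_def f.add f.scaleR algebra_simps)
    then have "0 \<le> 2 * t * d + t\<^sup>2 * (norm y)\<^sup>2"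
      using min[of "z + t *\<^sub>R y"] by simp
    also have "\<dots> \<le> 2 * t * d + t\<^sup>2 * ((norm y)\<^sup>2 + 1)"
      by (simp add: algebra_simps)
    also have "\<dots> = - (d\<^sup>2 / ((norm y)\<^sup>2 + 1))"
      using ny by (simp add: t_def power2_eq_square divide_simps)
    also have "\<dots> < 0"
      using d ny by simp
    finally show False by simp
  qed
  then show ?thesis by blast
qed

text \<open>\<open>adjoint\<close> is defined by choice; Riesz supplies the existence that the
  choice requires.\<close>

lemma adjoint_inner:
  fixes A :: "'a::{real_inner, complete_space} \<Rightarrow> 'b::real_inner"
  assumes "bounded_linear A"
  shows "A x \<bullet> y = x \<bullet> adjoint A y"
proof -
  have "\<forall>y. \<exists>z. \<forall>x. A x \<bullet> y = z \<bullet> x"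
    by (intro allI riesz_representation bounded_linear_inner_left_comp assms)
  then have "\<exists>f'. \<forall>x y. A x \<bullet> y = x \<bullet> f' y"
    by (metis inner_commute)
  then have "\<forall>x y. A x \<bullet> y = x \<bullet> adjoint A y"
    unfolding adjoint_def by (rule someI_ex)
  then show ?thesis by blast
qed

section \<open>Normal functionals on bounded Borel functions\<close>

definition bounded_borel :: "(real \<Rightarrow> real) set" where
  "bounded_borel = {\<phi>. \<phi> \<in> borel_measurable borel \<and> (\<exists>K. \<forall>x. \<bar>\<phi> x\<bar> \<le> K)}"

lemma bounded_borelI:
  "\<phi> \<in> borel_measurable borel \<Longrightarrow> (\<And>x. \<bar>\<phi> x\<bar> \<le> K) \<Longrightarrow> \<phi> \<in> bounded_borel"
  by (auto simp: bounded_borel_def)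

lemma bounded_borel_measurable [measurable_dest]: "\<phi> \<in> bounded_borel \<Longrightarrow> \<phi> \<in> borel_measurable borel"
  by (simp add: bounded_borel_def)

lemma bounded_borel_const [simp]: "(\<lambda>_. c) \<in> bounded_borel"
  by (rule bounded_borelI[where K = "\<bar>c\<bar>"]) auto

lemma bounded_borel_indicator [simp]: "S \<in> sets borel \<Longrightarrow> indicator S \<in> bounded_borel"
  by (rule bounded_borelI[where K = 1]) (auto simp: indicator_def)

lemma bounded_borel_add [simp]:
  assumes "\<phi> \<in> bounded_borel" "\<psi> \<in> bounded_borel"
  shows "(\<lambda>x. \<phi> x + \<psi> x) \<in> bounded_borel"
proof -
  obtain K L where "\<And>x. \<bar>\<phi> x\<bar> \<le> K" "\<And>x. \<bar>\<psi> x\<bar> \<le> L"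
    using assms by (auto simp: bounded_borel_def)
  then have "\<bar>\<phi> x + \<psi> x\<bar> \<le> K + L" for x
    by (meson abs_triangle_ineq add_mono order_trans)
  with assms show ?thesis
    by (intro bounded_borelI[where K = "K + L"]) auto
qed

lemma bounded_borel_mult [simp]:
  assumes "\<phi> \<in> bounded_borel" "\<psi> \<in> bounded_borel"
  shows "(\<lambda>x. \<phi> x * \<psi> x) \<in> bounded_borel"
proof -
  obtain K L where "\<And>x. \<bar>\<phi> x\<bar> \<le> K" "\<And>x. \<bar>\<psi> x\<bar> \<le> L"
    using assms by (auto simp: bounded_borel_def)
  then have "\<bar>\<phi> x * \<psi> x\<bar> \<le> K * L" for x
    unfolding abs_mult by (meson abs_ge_zero mult_mono order_trans)
  with assms show ?thesis
    by (intro bounded_borelI[where K = "K * L"]) auto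
qed

lemma bounded_borel_diff [simp]:
  assumes "\<phi> \<in> bounded_borel" "\<psi> \<in> bounded_borel"
  shows "(\<lambda>x. \<phi> x - \<psi> x) \<in> bounded_borel"
  using bounded_borel_add[OF assms(1) bounded_borel_mult[OF bounded_borel_const[of "-1"] assms(2)]]
  by simp

lemma bounded_borel_sum [simp]:
  "(\<And>i. i \<in> I \<Longrightarrow> \<phi> i \<in> bounded_borel) \<Longrightarrow> (\<lambda>x. \<Sum>i\<in>I. \<phi> i x) \<in> bounded_borel"
  by (induction I rule: infinite_finite_induct) simp_all

text \<open>Bounded pointwise convergence, with one bound for all \<open>n\<close> and
  \<open>x\<close>: the situation of dominated convergence over every finite measure at
  once.\<close>

definition bounded_limit :: "(nat \<Rightarrow> real \<Rightarrow> real) \<Rightarrow> (real \<Rightarrow> real) \<Rightarrow> bool" where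
  "bounded_limit F \<phi> \<longleftrightarrow> (\<forall>n. F n \<in> borel_measurable borel) \<and>
     (\<exists>K. \<forall>n x. \<bar>F n x\<bar> \<le> K) \<and> (\<forall>x. (\<lambda>n. F n x) \<longlonglongrightarrow> \<phi> x)"

lemma bounded_limit_bounded_borel:
  assumes "bounded_limit F \<phi>"
  shows "F n \<in> bounded_borel" "\<phi> \<in> bounded_borel"
proof -
  obtain K where K: "\<And>n x. \<bar>F n x\<bar> \<le> K" and [measurable]: "\<And>n. F n \<in> borel_measurable borel"
    and lim: "\<And>x. (\<lambda>n. F n x) \<longlonglongrightarrow> \<phi> x"
    using assms unfolding bounded_limit_def by blast
  show "F n \<in> bounded_borel"
    using K by (intro bounded_borelI[where K = K]) auto
  have "\<phi> \<in> borel_measurable borel"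
    by (rule borel_measurable_LIMSEQ_real[OF lim]) auto
  moreover have "\<bar>\<phi> x\<bar> \<le> K" for x
    by (rule LIMSEQ_le_const2[OF tendsto_rabs[OF lim]]) (use K in auto)
  ultimately show "\<phi> \<in> bounded_borel"
    by (rule bounded_borelI)
qed

text \<open>Stands for integration against a finite signed measure. Polarisation produces
  differences of measures, and identities between them are proved in this form.\<close>

definition normal_functional :: "((real \<Rightarrow> real) \<Rightarrow> real) \<Rightarrow> bool" where
  "normal_functional \<Lambda> \<longleftrightarrow>
     (\<forall>\<phi>\<in>bounded_borel. \<forall>\<psi>\<in>bounded_borel. \<Lambda> (\<lambda>x. \<phi> x + \<psi> x) = \<Lambda> \<phi> + \<Lambda> \<psi>) \<and>
     (\<forall>\<phi>\<in>bounded_borel. \<forall>c. \<Lambda> (\<lambda>x. c * \<phi> x) = c * \<Lambda> \<phi>) \<and>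
     (\<forall>F \<phi>. bounded_limit F \<phi> \<longrightarrow> (\<lambda>n. \<Lambda> (F n)) \<longlonglongrightarrow> \<Lambda> \<phi>)"

lemma normal_functionalD:
  assumes "normal_functional \<Lambda>"
  shows "\<And>\<phi> \<psi>. \<phi> \<in> bounded_borel \<Longrightarrow> \<psi> \<in> bounded_borel \<Longrightarrow> \<Lambda> (\<lambda>x. \<phi> x + \<psi> x) = \<Lambda> \<phi> + \<Lambda> \<psi>"
    and "\<And>\<phi> c. \<phi> \<in> bounded_borel \<Longrightarrow> \<Lambda> (\<lambda>x. c * \<phi> x) = c * \<Lambda> \<phi>"
    and "\<And>F \<phi>. bounded_limit F \<phi> \<Longrightarrow> (\<lambda>n. \<Lambda> (F n)) \<longlonglongrightarrow> \<Lambda> \<phi>"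
  using assms unfolding normal_functional_def by blast+

lemma normal_functional_zero:
  assumes "normal_functional \<Lambda>"
  shows "\<Lambda> (\<lambda>_. 0) = 0"
  using normal_functionalD(2)[OF assms bounded_borel_const, of 0 0] by simp

lemma normal_functional_sum:
  assumes \<Lambda>: "normal_functional \<Lambda>" and "\<And>i. i \<in> I \<Longrightarrow> \<phi> i \<in> bounded_borel"
  shows "\<Lambda> (\<lambda>x. \<Sum>i\<in>I. \<phi> i x) = (\<Sum>i\<in>I. \<Lambda> (\<phi> i))"
  using assms(2)
proof (induction I rule: infinite_finite_induct)
  case (insert i I)
  then show ?case
    using normal_functionalD(1)[OF \<Lambda>, of "\<phi> i" "\<lambda>x. \<Sum>i\<in>I. \<phi> i x"] by simp
qed (simp_all add: normal_functional_zero[OF \<Lambda>])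

lemma normal_functional_add:
  "normal_functional \<Lambda> \<Longrightarrow> normal_functional \<Lambda>' \<Longrightarrow> normal_functional (\<lambda>\<phi>. \<Lambda> \<phi> + \<Lambda>' \<phi>)"
  unfolding normal_functional_def by (auto intro!: tendsto_add simp: algebra_simps)

lemma normal_functional_cmult:
  "normal_functional \<Lambda> \<Longrightarrow> normal_functional (\<lambda>\<phi>. c * \<Lambda> \<phi>)"
  unfolding normal_functional_def by (auto intro!: tendsto_mult_left simp: algebra_simps)

lemma normal_functional_diff:
  "normal_functional \<Lambda> \<Longrightarrow> normal_functional \<Lambda>' \<Longrightarrow> normal_functional (\<lambda>\<phi>. \<Lambda> \<phi> - \<Lambda>' \<phi>)"
  unfolding normal_functional_def by (auto intro!: tendsto_diff simp: algebra_simps)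

lemma bounded_limit_mult:
  assumes "bounded_limit F \<phi>" "g \<in> bounded_borel"
  shows "bounded_limit (\<lambda>n x. F n x * g x) (\<lambda>x. \<phi> x * g x)"
proof -
  obtain K where K: "\<And>n x. \<bar>F n x\<bar> \<le> K" and [measurable]: "\<And>n. F n \<in> borel_measurable borel"
    and lim: "\<And>x. (\<lambda>n. F n x) \<longlonglongrightarrow> \<phi> x"
    using assms unfolding bounded_limit_def by blast
  obtain L where L: "\<And>x. \<bar>g x\<bar> \<le> L" and [measurable]: "g \<in> borel_measurable borel"
    using assms by (auto simp: bounded_borel_def)
  have "\<bar>F n x * g x\<bar> \<le> K * L" for n x
    unfolding abs_mult using K L by (meson abs_ge_zero mult_mono order_trans)
  then show ?thesis
    unfolding bounded_limit_def using lim by (auto intro!: tendsto_mult_right)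
qed

lemma normal_functional_mult:
  assumes \<Lambda>: "normal_functional \<Lambda>" and g: "g \<in> bounded_borel"
  shows "normal_functional (\<lambda>\<phi>. \<Lambda> (\<lambda>x. \<phi> x * g x))"
  unfolding normal_functional_def
proof (intro conjI ballI allI impI)
  fix \<phi> \<psi> assume "\<phi> \<in> bounded_borel" "\<psi> \<in> bounded_borel"
  then show "\<Lambda> (\<lambda>x. (\<phi> x + \<psi> x) * g x) = \<Lambda> (\<lambda>x. \<phi> x * g x) + \<Lambda> (\<lambda>x. \<psi> x * g x)"
    using normal_functionalD(1)[OF \<Lambda>, of "\<lambda>x. \<phi> x * g x" "\<lambda>x. \<psi> x * g x"] g
    by (simp add: distrib_right)
next
  fix \<phi> and c :: real assume "\<phi> \<in> bounded_borel"
  then show "\<Lambda> (\<lambda>x. c * \<phi> x * g x) = c * \<Lambda> (\<lambda>x. \<phi> x * g x)"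
    using normal_functionalD(2)[OF \<Lambda>, of "\<lambda>x. \<phi> x * g x" c] g by (simp add: mult.assoc)
next
  fix F \<phi> assume "bounded_limit F \<phi>"
  then show "(\<lambda>n. \<Lambda> (\<lambda>x. F n x * g x)) \<longlonglongrightarrow> \<Lambda> (\<lambda>x. \<phi> x * g x)"
    by (intro normal_functionalD(3)[OF \<Lambda>] bounded_limit_mult g)
qed

lemma integrable_bounded_borel:
  assumes "finite_measure M" "sets M = sets borel" "\<phi> \<in> bounded_borel"
  shows "integrable M \<phi>"
proof -
  interpret finite_measure M by fact
  obtain K where "\<And>x. \<bar>\<phi> x\<bar> \<le> K"
    using assms by (auto simp: bounded_borel_def)
  then show ?thesis
    using assms(3) by (intro integrable_const_bound[where B = K])
      (auto simp: measurable_cong_sets[OF assms(2) refl] bounded_borel_measurable)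
qed

lemma normal_functional_integral:
  assumes "finite_measure M" "sets M = sets borel"
  shows "normal_functional (\<lambda>\<phi>. \<integral>x. \<phi> x \<partial>M)"
  unfolding normal_functional_def
proof (intro conjI ballI allI impI)
  interpret finite_measure M by fact
  fix F \<phi> assume F: "bounded_limit F \<phi>"
  note b = bounded_limit_bounded_borel[OF F]
  obtain K where K: "\<And>n x. \<bar>F n x\<bar> \<le> K" and lim: "\<And>x. (\<lambda>n. F n x) \<longlonglongrightarrow> \<phi> x"
    using F unfolding bounded_limit_def by blast
  show "(\<lambda>n. \<integral>x. F n x \<partial>M) \<longlonglongrightarrow> (\<integral>x. \<phi> x \<partial>M)"
    by (rule integral_dominated_convergence[where w = "\<lambda>_. K"])
      (use b K lim in \<open>auto simp: measurable_cong_sets[OF assms(2) refl] bounded_borel_measurable\<close>)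
qed (simp_all add: integrable_bounded_borel[OF assms])

text \<open>\<open>\<phi>\<close> is a bounded limit of simple functions, which are finite
  combinations of indicators.\<close>

lemma normal_functional_eq_zero_if_indicator:
  assumes \<Lambda>: "normal_functional \<Lambda>"
    and ind: "\<And>S. S \<in> sets borel \<Longrightarrow> \<Lambda> (indicator S) = 0"
    and \<phi>: "\<phi> \<in> bounded_borel"
  shows "\<Lambda> \<phi> = 0"
proof -
  have [measurable]: "\<phi> \<in> borel_measurable borel"
    using \<phi> by (rule bounded_borel_measurable)
  obtain K where K: "\<And>x. \<bar>\<phi> x\<bar> \<le> K"
    using \<phi> by (auto simp: bounded_borel_def)
  obtain F where F: "\<And>i. simple_function borel (F i)" "\<And>x. (\<lambda>i. F i x) \<longlonglongrightarrow> \<phi> x"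
    "\<And>i x. \<bar>F i x\<bar> \<le> 2 * \<bar>\<phi> x\<bar>"
    using borel_measurable_implies_sequence_metric[of \<phi> borel 0] by auto
  have "bounded_limit F \<phi>"
    unfolding bounded_limit_def
  proof (intro conjI allI exI)
    fix n x
    show "\<bar>F n x\<bar> \<le> 2 * K"
      using F(3)[of n x] K[of x] by linarith
  qed (use F in \<open>auto intro: borel_measurable_simple_function\<close>)
  then have "(\<lambda>n. \<Lambda> (F n)) \<longlonglongrightarrow> \<Lambda> \<phi>"
    by (rule normal_functionalD(3)[OF \<Lambda>])
  moreover have "\<Lambda> (F n) = 0" for n
  proof -
    have fin: "finite (range (F n))"
      using F(1)[of n] by (auto simp: simple_function_def)
    have meas: "F n -` {y} \<in> sets borel" for y
      using borel_measurable_simple_function[OF F(1)[of n]] measurable_sets_borel[of "F n" borel "{y}"]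
      by simp
    have "F n = (\<lambda>x. \<Sum>y\<in>range (F n). y * indicator (F n -` {y}) x)"
    proof
      fix x
      have "(\<Sum>y\<in>range (F n). y * indicator (F n -` {y}) x) = (\<Sum>y\<in>range (F n). if y = F n x then y else 0)"
        by (intro sum.cong) (auto simp: indicator_def)
      then show "F n x = (\<Sum>y\<in>range (F n). y * indicator (F n -` {y}) x)"
        using fin by simp
    qed
    then have "\<Lambda> (F n) = (\<Sum>y\<in>range (F n). \<Lambda> (\<lambda>x. y * indicator (F n -` {y}) x))"
      using normal_functional_sum[OF \<Lambda>, of "range (F n)" "\<lambda>y x. y * indicator (F n -` {y}) x"] meas
      by simp
    also have "\<dots> = 0"
      using meas by (simp add: normal_functionalD(2)[OF \<Lambda>] ind)
    finally show ?thesis .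
  qed
  ultimately show ?thesis
    by (simp add: LIMSEQ_const_iff)
qed

lemma normal_functional_eq_if_indicator:
  assumes "normal_functional \<Lambda>" "normal_functional \<Lambda>'"
    and "\<And>S. S \<in> sets borel \<Longrightarrow> \<Lambda> (indicator S) = \<Lambda>' (indicator S)"
    and "\<phi> \<in> bounded_borel"
  shows "\<Lambda> \<phi> = \<Lambda>' \<phi>"
  using normal_functional_eq_zero_if_indicator[OF normal_functional_diff[OF assms(1,2)] _ assms(4)] assms(3)
  by simp

text \<open>Dynkin's argument: half-lines are stable under intersection and generate the Borel sets.
  The whole line, on which complements depend, is the limit of \<open>{..real n}\<close>.\<close>

lemma normal_functional_eq_zero_if_atMost:
  assumes \<Lambda>: "normal_functional \<Lambda>"
    and at: "\<And>a. \<Lambda> (indicator {..a}) = 0"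
    and \<phi>: "\<phi> \<in> bounded_borel"
  shows "\<Lambda> \<phi> = 0"
proof (rule normal_functional_eq_zero_if_indicator[OF \<Lambda> _ \<phi>])
  have "bounded_limit (\<lambda>n. indicator {..real n}) (\<lambda>_. 1)"
    unfolding bounded_limit_def
  proof (intro conjI allI exI)
    fix x :: real
    obtain N where "x \<le> real N" using real_arch_simple by blast
    then have "eventually (\<lambda>n. indicator {..real n} x = (1::real)) sequentially"
      by (intro eventually_sequentiallyI[of N]) (auto simp: indicator_def)
    then show "(\<lambda>n. indicator {..real n} x) \<longlonglongrightarrow> (1::real)"
      by (rule tendsto_eventually)
    show "\<bar>indicator {..real n} x\<bar> \<le> (1::real)" for n
      by (simp add: indicator_def)
  qed auto
  from normal_functionalD(3)[OF \<Lambda> this] have one: "\<Lambda> (\<lambda>_. 1) = 0"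
    by (simp add: at LIMSEQ_const_iff)
  fix S :: "real set" assume "S \<in> sets borel"
  then have "S \<in> sigma_sets UNIV (range atMost)"
    by (simp add: borel_eq_atMost)
  then show "\<Lambda> (indicator S) = 0"
  proof (induction S rule: sigma_sets_induct_disjoint[rotated 2, consumes 1, case_names basic empty compl union stable closed])
    case (compl A)
    then have [simp]: "A \<in> sets borel" by (simp add: borel_eq_atMost)
    have "indicator (UNIV - A) = (\<lambda>x. 1 + (-1) * indicator A x :: real)"
      by (auto simp: indicator_def)
    then show ?case
      using compl normal_functionalD(1)[OF \<Lambda>, of "\<lambda>_. 1" "\<lambda>x. (-1) * indicator A x"]
        normal_functionalD(2)[OF \<Lambda>, of "indicator A" "-1"] one
        bounded_borel_mult[OF bounded_borel_const[of "-1"] bounded_borel_indicator[of A]]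
      by (simp del: mult_minus_left mult_minus1)
  next
    case (union A)
    then have A: "A i \<in> sets borel" for i by (auto simp: borel_eq_atMost)
    have ind: "(\<Sum>i<n. indicator (A i) x) = (indicator (\<Union>i<n. A i) x :: real)" for n x
      using union(1) by (intro indicator_UN_disjoint[symmetric]) (auto simp: disjoint_family_on_def)
    have "bounded_limit (\<lambda>n x. \<Sum>i<n. indicator (A i) x) (indicator (\<Union>i. A i))"
      unfolding bounded_limit_def ind
    proof (intro conjI allI exI)
      fix x n
      show "\<bar>indicator (\<Union>i<n. A i) x\<bar> \<le> (1::real)"
        by (simp add: indicator_def)
      show "(\<lambda>n. indicator (\<Union>i<n. A i) x) \<longlonglongrightarrow> (indicator (\<Union>i. A i) x :: real)"
        by (rule LIMSEQ_indicator_UN)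
    qed (use A in auto)
    from normal_functionalD(3)[OF \<Lambda> this] show ?case
      using A union by (simp add: normal_functional_sum[OF \<Lambda>] LIMSEQ_const_iff)
  next
    case stable
    show ?case by (auto simp: Int_stable_def)
  next
    case empty
    have "indicator {} = (\<lambda>_. 0 :: real)" by auto
    then show ?case by (simp add: normal_functional_zero[OF \<Lambda>])
  qed (auto simp: at)
qed

text \<open>A signed measure on \<open>[0, m]\<close> is determined by its moments: vanishing passes
  from polynomials to continuous functions by Weierstrass, then to half-lines by continuous ramps,
  then to all bounded Borel functions.\<close>

lemma normal_functional_eq_zero_if_moments:
  assumes \<Lambda>: "normal_functional \<Lambda>"
    and conc: "\<And>\<phi>. \<phi> \<in> bounded_borel \<Longrightarrow> (\<And>t. t \<in> {0..m} \<Longrightarrow> \<phi> t = 0) \<Longrightarrow> \<Lambda> \<phi> = 0"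
    and mom: "\<And>k. \<Lambda> (\<lambda>t. t ^ k * indicator {0..m} t) = 0"
    and \<phi>: "\<phi> \<in> bounded_borel"
  shows "\<Lambda> \<phi> = 0"
proof -
  have bb: "(\<lambda>t. f t * indicator {0..m} t) \<in> bounded_borel" if f: "continuous_on UNIV f" for f :: "real \<Rightarrow> real"
  proof -
    have "bounded (f ` {0..m})"
      by (intro compact_imp_bounded compact_continuous_image continuous_on_subset[OF f]) auto
    then obtain K where K: "K > 0" "\<And>t. t \<in> {0..m} \<Longrightarrow> \<bar>f t\<bar> \<le> K"
      by (auto simp: bounded_pos)
    have [measurable]: "f \<in> borel_measurable borel"
      using f by (rule borel_measurable_continuous_onI)
    show ?thesis
      using K by (intro bounded_borelI[where K = K]) (auto simp: indicator_def)
  qed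
  have poly: "\<Lambda> (\<lambda>t. g t * indicator {0..m} t) = 0" if g: "real_polynomial_function g" for g :: "real \<Rightarrow> real"
  proof -
    obtain a n where g: "g = (\<lambda>x. \<Sum>i\<le>n. a i * x ^ i)"
      using g by (auto simp: real_polynomial_function_iff_sum)
    have b: "(\<lambda>t. t ^ i * indicator {0..m} t) \<in> bounded_borel" for i :: nat
      by (rule bb) (intro continuous_intros)
    have "(\<lambda>t. g t * indicator {0..m} t) = (\<lambda>t. \<Sum>i\<le>n. a i * (t ^ i * indicator {0..m} t))"
      by (simp add: g sum_distrib_right mult.assoc)
    moreover have "\<Lambda> (\<lambda>t. \<Sum>i\<le>n. a i * (t ^ i * indicator {0..m} t)) =
        (\<Sum>i\<le>n. a i * \<Lambda> (\<lambda>t. t ^ i * indicator {0..m} t))"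
      by (subst normal_functional_sum[OF \<Lambda>]) (simp_all add: b normal_functionalD(2)[OF \<Lambda>])
    ultimately show ?thesis by (simp add: mom)
  qed
  have cont: "\<Lambda> (\<lambda>t. f t * indicator {0..m} t) = 0" if f: "continuous_on UNIV f" for f :: "real \<Rightarrow> real"
  proof -
    obtain K where K: "\<And>t. \<bar>f t * indicator {0..m} t\<bar> \<le> K"
      using bb[OF f] by (auto simp: bounded_borel_def)
    have "\<exists>g. real_polynomial_function g \<and> (\<forall>t\<in>{0..m}. \<bar>f t - g t\<bar> < inverse (real (Suc n)))" for n
      using Stone_Weierstrass_real_polynomial_function[of "{0..m}" f "inverse (real (Suc n))"]
        continuous_on_subset[OF f] by (metis compact_Icc inverse_positive_iff_positive of_nat_0_less_iff subset_UNIV zero_less_Suc)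
    then obtain g where g: "\<And>n. real_polynomial_function (g n)"
      "\<And>n t. t \<in> {0..m} \<Longrightarrow> \<bar>f t - g n t\<bar> < inverse (real (Suc n))"
      by metis
    have err: "\<bar>g n t * indicator {0..m} t - f t * indicator {0..m} t\<bar> \<le> inverse (real (Suc n))" for n t
      using g(2)[of t n] by (auto simp: indicator_def)
    have "bounded_limit (\<lambda>n t. g n t * indicator {0..m} t) (\<lambda>t. f t * indicator {0..m} t)"
      unfolding bounded_limit_def
    proof (intro conjI allI exI)
      fix n t
      have "continuous_on UNIV (g n)"
        using continuous_on_polymonial_function[OF g(1)[unfolded real_polynomial_function_eq]] .
      then show "(\<lambda>t. g n t * indicator {0..m} t) \<in> borel_measurable borel"
        by (rule bounded_borel_measurable[OF bb])
      have "inverse (real (Suc n)) \<le> 1"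
        by (simp add: inverse_le_1_iff)
      then show "\<bar>g n t * indicator {0..m} t\<bar> \<le> K + 1"
        using err[of n t] K[of t] by linarith
      show "(\<lambda>n. g n t * indicator {0..m} t) \<longlonglongrightarrow> f t * indicator {0..m} t"
        by (rule LIM_zero_cancel, rule Lim_null_comparison[OF always_eventually LIMSEQ_inverse_real_of_nat])
          (use err in auto)
    qed
    from normal_functionalD(3)[OF \<Lambda> this] show ?thesis
      by (simp add: poly[OF g(1)] LIMSEQ_const_iff)
  qed
  have ind: "\<Lambda> (\<lambda>t. indicator {..a} t * indicator {0..m} t) = 0" for a
  proof -
    \<comment> \<open>For \<open>n > 0\<close> a ramp: \<open>1\<close> up to \<open>a\<close>,
      falling to \<open>0\<close> on \<open>[a, a + 1/n]\<close>. The limit is the indicator of the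
      closed half-line.\<close>
    define f where "f n t = max 0 (min 1 (1 - real n * (t - a)))" for n t
    have "bounded_limit (\<lambda>n t. f n t * indicator {0..m} t) (\<lambda>t. indicator {..a} t * indicator {0..m} t)"
    proof (rule bounded_limit_mult)
      show "bounded_limit f (indicator {..a})"
        unfolding bounded_limit_def
      proof (intro conjI allI exI)
        fix n t
        show "f n \<in> borel_measurable borel" unfolding f_def by measurable
        show "\<bar>f n t\<bar> \<le> 1" by (simp add: f_def)
        show "(\<lambda>n. f n t) \<longlonglongrightarrow> indicator {..a} t"
        proof (cases "t \<le> a")
          case True
          then have "f n t = 1" for n by (simp add: f_def mult_nonneg_nonpos)
          then show ?thesis using True by simp
        next
          case False
          obtain N where "1 / (t - a) \<le> real N" using real_arch_simple by blast
          then have "1 \<le> real n * (t - a)" if "n \<ge> N" for n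
          proof -
            have "1 \<le> real N * (t - a)"
              using \<open>1 / (t - a) \<le> real N\<close> False by (simp add: pos_divide_le_eq)
            also have "\<dots> \<le> real n * (t - a)"
              using False that by (intro mult_right_mono) auto
            finally show ?thesis .
          qed
          then have "f n t = 0" if "n \<ge> N" for n
            using that by (force simp: f_def)
          then have "eventually (\<lambda>n. f n t = 0) sequentially"
            by (intro eventually_sequentiallyI[of N])
          then show ?thesis using False by (simp add: tendsto_eventually)
        qed
      qed
    qed simp
    moreover have "continuous_on UNIV (f n)" for n
      unfolding f_def by (intro continuous_intros)
    ultimately show ?thesis
      using normal_functionalD(3)[OF \<Lambda>] cont by (fastforce simp: LIMSEQ_const_iff)
  qed
  have "\<Lambda> (\<lambda>t. \<phi> t * indicator {0..m} t) = 0"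
    by (rule normal_functional_eq_zero_if_atMost[OF normal_functional_mult[OF \<Lambda>] ind \<phi>]) simp
  moreover have "\<Lambda> (\<lambda>t. \<phi> t * indicator (- {0..m}) t) = 0"
    using \<phi> by (intro conc) auto
  moreover have "\<phi> = (\<lambda>t. \<phi> t * indicator {0..m} t + \<phi> t * indicator (- {0..m}) t)"
    by (auto simp: indicator_def)
  ultimately show ?thesis
    using normal_functionalD(1)[OF \<Lambda>, of "\<lambda>t. \<phi> t * indicator {0..m} t" "\<lambda>t. \<phi> t * indicator (- {0..m}) t"] \<phi>
    by simp
qed

section \<open>The Hausdorff moment problem\<close>

lemma sum_binomial_Suc:
  fixes f :: "nat \<Rightarrow> 'a::comm_semiring_1"
  shows "(\<Sum>k\<le>Suc n. of_nat (Suc n choose k) * f k) =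
    (\<Sum>k\<le>n. of_nat (n choose k) * f k) + (\<Sum>k\<le>n. of_nat (n choose k) * f (Suc k))"
proof -
  have "(\<Sum>k\<le>Suc n. of_nat (n choose k) * f k) = f 0 + (\<Sum>k\<le>n. of_nat (n choose Suc k) * f (Suc k))"
    by (subst sum.atMost_Suc_shift) simp
  then have "(\<Sum>k\<le>n. of_nat (n choose k) * f k) = f 0 + (\<Sum>k\<le>n. of_nat (n choose Suc k) * f (Suc k))"
    by (simp add: binomial_eq_0)
  moreover have "(\<Sum>k\<le>Suc n. of_nat (Suc n choose k) * f k) =
      f 0 + (\<Sum>k\<le>n. of_nat (n choose k) * f (Suc k)) + (\<Sum>k\<le>n. of_nat (n choose Suc k) * f (Suc k))"
    by (subst sum.atMost_Suc_shift) (simp add: sum.distrib algebra_simps)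
  ultimately show ?thesis by (simp add: algebra_simps)
qed

text \<open>For \<open>b i j = \<integral> t^i (1 - t)^j\<close> this expands
  \<open>1 = (t + (1 - t))^n\<close> under the integral; \<open>rec\<close> is the case
  \<open>n = 1\<close>.\<close>

lemma difference_scheme_expand:
  fixes b :: "nat \<Rightarrow> nat \<Rightarrow> real"
  assumes rec: "\<And>i j. b i j = b (Suc i) j + b i (Suc j)"
  shows "b i j = (\<Sum>k\<le>n. real (n choose k) * b (i + k) (j + n - k))"
proof (induction n arbitrary: i j)
  case (Suc n)
  have "b i j = (\<Sum>k\<le>n. real (n choose k) * b (i + k) (Suc j + n - k)) +
      (\<Sum>k\<le>n. real (n choose k) * b (Suc i + k) (j + n - k))"
    using rec[of i j] Suc.IH[of i "Suc j"] Suc.IH[of "Suc i" j] by linarith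
  then show ?case
    by (simp only: sum_binomial_Suc) simp
qed simp

text \<open>The ratio is the product of \<open>(k - j) / (n - j)\<close> over \<open>j < i\<close>,
  whose factors approach \<open>k / n\<close>. Such ratios replace the powers of the nodes
  \<open>k / n\<close> below, because with them the moment sums become exact.\<close>

lemma binomial_ratio_approx:
  assumes "0 < e"
  shows "\<exists>N. \<forall>n\<ge>N. \<forall>k\<le>n. \<bar>(real k / real n) ^ i - real (k choose i) / real (n choose i)\<bar> < e"
  using assms
proof (induction i arbitrary: e)
  case (Suc i)
  obtain N1 where N1: "\<And>n k. n \<ge> N1 \<Longrightarrow> k \<le> n \<Longrightarrow>
      \<bar>(real k / real n) ^ i - real (k choose i) / real (n choose i)\<bar> < e / 2"
    using Suc.IH[of "e / 2"] Suc.prems by auto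
  obtain N2 where N2: "2 * (real i + 1) / e < real N2"
    using reals_Archimedean2 by blast
  show ?case
  proof (intro exI allI impI)
    \<comment> \<open>\<open>N1\<close> serves the induction hypothesis, \<open>N2\<close> makes
      \<open>i / (n - i)\<close> smaller than \<open>e / 2\<close>, and \<open>i + 1\<close> ensures
      \<open>i < n\<close>.\<close>
    fix n k :: nat assume n: "N1 + N2 + i + 1 \<le> n" and k: "k \<le> n"
    define p where "p = real (k choose i) / real (n choose i)"
    define x where "x = real k / real n"
    have n0: "n > i" "real n > 0" "real (n choose i) > 0" using n by auto
    have p01: "0 \<le> p" "p \<le> 1"
      using n0 k binomial_right_mono[OF k, of i] by (auto simp: p_def)
    have x01: "0 \<le> x" "x \<le> 1" using n0 k by (auto simp: x_def)
    have step: "real (m choose Suc i) = real (m choose i) * (real m - real i) / (real i + 1)" for m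
    proof (cases "i \<le> m")
      case True
      have "Suc i * (m choose Suc i) = (m choose i) * (m - i)"
        using binomial_absorb_comp[of m i] binomial_absorption[of i m] by (metis mult.commute)
      then have "real (Suc i) * real (m choose Suc i) = real (m choose i) * real (m - i)"
        by (metis of_nat_mult)
      then show ?thesis using True by (simp add: of_nat_diff field_simps)
    qed (simp add: binomial_eq_0)
    have eq: "real (k choose Suc i) / real (n choose Suc i) = p * ((real k - real i) / (real n - real i))"
      unfolding step p_def using n0 by simp
    have small: "\<bar>x * p - p * ((real k - real i) / (real n - real i))\<bar> < e / 2"
    proof (cases "i \<le> k")
      case True
      have "x - (real k - real i) / (real n - real i) = real i * (1 - x) / (real n - real i)"
        using n0 by (simp add: x_def field_simps)
      then have "\<bar>x - (real k - real i) / (real n - real i)\<bar> \<le> real i / (real n - real i)"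
        using x01 n0 by (simp add: abs_mult divide_right_mono mult_left_le)
      also have "\<dots> < e / 2"
      proof -
        have "2 * (real i + 1) < e * real N2"
          using N2 Suc.prems by (simp add: field_simps)
        also have "\<dots> \<le> e * (real n - real i)"
          using n Suc.prems by (intro mult_left_mono) auto
        finally show ?thesis using n0 by (simp add: field_simps)
      qed
      finally have "\<bar>p\<bar> * \<bar>x - (real k - real i) / (real n - real i)\<bar> < e / 2"
        using p01 mult_left_le_one_le[of "\<bar>x - (real k - real i) / (real n - real i)\<bar>" p] by simp
      moreover have "x * p - p * ((real k - real i) / (real n - real i)) =
          p * (x - (real k - real i) / (real n - real i))"
        by (simp add: right_diff_distrib mult.commute)
      ultimately show ?thesis by (simp only: abs_mult)
    next
      case False
      then show ?thesis using Suc.prems by (simp add: p_def binomial_eq_0)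
    qed
    have "\<bar>x ^ Suc i - x * p\<bar> = x * \<bar>x ^ i - p\<bar>"
      using x01 by (simp add: abs_mult right_diff_distrib[symmetric])
    also have "\<dots> \<le> \<bar>x ^ i - p\<bar>"
      using x01 by (simp add: mult_left_le_one_le)
    also have "\<dots> < e / 2"
      unfolding x_def p_def using N1[of n k] n k by auto
    finally show "\<bar>(real k / real n) ^ Suc i - real (k choose Suc i) / real (n choose Suc i)\<bar> < e"
      unfolding eq x_def[symmetric] using small by linarith
  qed
qed auto

text \<open>
  The discrete measures with mass \<open>(n choose k) * b k (n - k)\<close> at \<open>k / n\<close> have asymptotically
  the right moments, and Helly's theorem provides a limit.
\<close>

theorem hausdorff_moment_problem_normalised:
  fixes b :: "nat \<Rightarrow> nat \<Rightarrow> real"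
  assumes nonneg: "\<And>i j. 0 \<le> b i j" and rec: "\<And>i j. b i j = b (Suc i) j + b i (Suc j)"
    and one: "b 0 0 = 1"
  shows "\<exists>M. real_distribution M \<and> (AE t in M. t \<in> {0..1}) \<and>
    (\<forall>i. (\<integral>t. t ^ i * indicator {0..1} t \<partial>M) = b i 0)"
proof -
  define w where "w n k = real (n choose k) * b k (n - k)" for n k
  have w_nonneg: "0 \<le> w n k" for n k
    by (simp add: w_def nonneg)
  have w_sum: "(\<Sum>k\<le>n. w n k) = 1" for n
    using difference_scheme_expand[of b 0 0 n, OF rec] one by (simp add: w_def)
  \<comment> \<open>At \<open>n = 0\<close> the only node is \<open>0 / 0 = 0\<close>, which lies in
    \<open>[0, 1]\<close> too.\<close>
  define x where "x n k = real k / real n" for n k :: nat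
  have x01: "x n k \<in> {0..1}" if "k \<le> n" for n k
    using that by (cases "n = 0") (auto simp: x_def divide_le_eq)
  define P where "P n = distr (point_measure {..n} (w n)) borel (x n)" for n
  have P_real: "real_distribution (P n)" for n
  proof -
    have "prob_space (point_measure {..n} (w n))"
      by (rule prob_spaceI)
        (simp add: space_point_measure emeasure_point_measure_finite sum_ennreal w_nonneg w_sum)
    then have "prob_space (P n)"
      unfolding P_def by (rule prob_space.prob_space_distr) (simp add: measurable_point_measure_eq1)
    then show ?thesis
      by (simp add: real_distribution_def real_distribution_axioms_def P_def)
  qed
  have P_int: "(\<integral>t. f t \<partial>P n) = (\<Sum>k\<le>n. w n k * f (x n k))"
    if "f \<in> borel_measurable borel" for f :: "real \<Rightarrow> real" and n
    unfolding P_def using that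
    by (subst integral_distr) (simp_all add: measurable_point_measure_eq1
        lebesgue_integral_point_measure_finite w_nonneg)
  have tight: "tight P"
    unfolding tight_def
  proof (intro conjI allI impI P_real)
    fix e :: real assume "0 < e"
    have "measure (P n) {-1<..1} = 1" for n
    proof -
      have "(\<integral>t. indicator {-1<..1} t \<partial>P n) = (\<Sum>k\<le>n. w n k * indicator {-1<..1} (x n k))"
        by (rule P_int) simp
      also have "\<dots> = (\<Sum>k\<le>n. w n k)"
        by (rule sum.cong) (use x01 in \<open>force simp: indicator_def\<close>)+
      finally show ?thesis by (simp add: w_sum P_def)
    qed
    with \<open>0 < e\<close> show "\<exists>a b. a < b \<and> (\<forall>n. 1 - e < measure (P n) {a<..b})"
      by (intro exI[of _ "-1"] exI[of _ 1]) auto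
  qed
  obtain r M where r: "strict_mono r" and M: "real_distribution M" and conv: "weak_conv_m (P \<circ> r) M"
    using tight_imp_convergent_subsubsequence[OF tight, of id] by (auto simp: strict_mono_def)
  interpret M: real_distribution M by fact
  have lim: "(\<lambda>n. \<Sum>k\<le>r n. w (r n) k * f (x (r n) k)) \<longlonglongrightarrow> (\<integral>t. f t \<partial>M)"
    if f: "continuous_on UNIV f" and K: "\<And>t. \<bar>f t\<bar> \<le> K" for f :: "real \<Rightarrow> real" and K
  proof -
    have "(\<lambda>n. \<integral>t. f t \<partial>(P \<circ> r) n) \<longlonglongrightarrow> (\<integral>t. f t \<partial>M)"
      by (rule weak_conv_imp_integral_bdd_continuous_conv[OF _ M conv, where B = K])
        (use f K P_real in \<open>auto simp: continuous_on_eq_continuous_at\<close>)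
    then show ?thesis
      using f by (simp add: P_int borel_measurable_continuous_onI)
  qed
  have AE01: "AE t in M. t \<in> {0..1}"
  proof -
    \<comment> \<open>Continuous, bounded and zero exactly on \<open>[0, 1]\<close>: its integral
      vanishes along the sequence, hence in the weak limit, which therefore lives on
      \<open>[0, 1]\<close>.\<close>
    define d where "d t = min 1 (max 0 (max (- t) (t - 1)))" for t :: real
    have d0: "d t = 0 \<longleftrightarrow> t \<in> {0..1}" for t
      by (auto simp: d_def min_def max_def)
    have d01: "0 \<le> d t" "\<bar>d t\<bar> \<le> 1" for t
      by (auto simp: d_def)
    have cont: "continuous_on UNIV d"
      unfolding d_def by (intro continuous_intros)
    have "w n k * d (x n k) = 0" if "k \<le> n" for n k
      using x01[OF that] d0 by simp
    then have "(\<Sum>k\<le>n. w n k * d (x n k)) = 0" for n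
      by (intro sum.neutral) auto
    then have "(\<integral>t. d t \<partial>M) = 0"
      using lim[OF cont d01(2)] by (simp add: LIMSEQ_const_iff)
    moreover have "integrable M d"
      by (rule M.integrable_const_bound[where B = 1])
        (use d01 cont in \<open>auto simp: borel_measurable_continuous_onI\<close>)
    ultimately have "AE t in M. d t = 0"
      using d01 by (subst (asm) integral_nonneg_eq_0_iff_AE) auto
    then show ?thesis by (simp add: d0)
  qed
  have "(\<integral>t. t ^ i * indicator {0..1} t \<partial>M) = b i 0" for i
  proof -
    \<comment> \<open>Weak convergence tests bounded continuous functions, so \<open>t^i\<close> is
      frozen outside \<open>[0, 1]\<close>.\<close>
    define f where "f t = (max 0 (min 1 t)) ^ i" for t :: real
    have f01: "f t = t ^ i" if "t \<in> {0..1}" for t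
      using that by (auto simp: f_def min_def max_def)
    have "(\<lambda>n. \<Sum>k\<le>r n. w (r n) k * f (x (r n) k)) \<longlonglongrightarrow> (\<integral>t. f t \<partial>M)"
    proof (rule lim)
      show "continuous_on UNIV f" unfolding f_def by (intro continuous_intros)
      show "\<bar>f t\<bar> \<le> 1" for t unfolding f_def by (auto intro!: power_le_one simp: power_abs[symmetric])
    qed
    moreover have "(\<lambda>n. \<Sum>k\<le>n. w n k * f (x n k)) \<longlonglongrightarrow> b i 0"
    proof (rule LIMSEQ_I)
      fix e :: real assume "0 < e"
      then obtain N where N: "\<And>n k. n \<ge> N \<Longrightarrow> k \<le> n \<Longrightarrow>
          \<bar>(real k / real n) ^ i - real (k choose i) / real (n choose i)\<bar> < e / 2"
        using binomial_ratio_approx[of "e / 2" i] by auto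
      have "\<bar>(\<Sum>k\<le>n. w n k * f (x n k)) - b i 0\<bar> < e" if n: "n \<ge> N + i" for n
      proof -
        \<comment> \<open>With the ratio in place of \<open>(k / n)^i\<close> the sum is exactly
          \<open>b i 0\<close>: \<open>choose_mult\<close> turns the weights into those of an
          expansion with \<open>n - i\<close> steps starting from \<open>b i 0\<close>.\<close>
        have "(\<Sum>k\<le>n. w n k * (real (k choose i) / real (n choose i))) =
            (\<Sum>k\<in>{i..n}. w n k * (real (k choose i) / real (n choose i)))"
          by (rule sum.mono_neutral_right) (auto simp: binomial_eq_0)
        also have "\<dots> = (\<Sum>k\<in>{i..n}. real (n - i choose (k - i)) * b k (n - k))"
        proof (rule sum.cong)
          fix k assume k: "k \<in> {i..n}"
          have "real (n choose k) * real (k choose i) = real (n choose i) * real (n - i choose (k - i))"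
            using choose_mult[of i k n] k by (metis atLeastAtMost_iff of_nat_mult)
          moreover have "real (n choose i) > 0" using n by simp
          ultimately show "w n k * (real (k choose i) / real (n choose i)) =
              real (n - i choose (k - i)) * b k (n - k)"
            by (simp add: w_def field_simps)
        qed simp
        also have "\<dots> = (\<Sum>l\<le>n - i. real (n - i choose l) * b (i + l) (0 + (n - i) - l))"
          by (rule sum.reindex_bij_witness[of _ "\<lambda>l. i + l" "\<lambda>k. k - i"]) (use n in auto)
        also have "\<dots> = b i 0"
          by (rule difference_scheme_expand[of b, OF rec, symmetric])
        finally have "b i 0 = (\<Sum>k\<le>n. w n k * (real (k choose i) / real (n choose i)))" ..
        then have "\<bar>(\<Sum>k\<le>n. w n k * f (x n k)) - b i 0\<bar> =
            \<bar>\<Sum>k\<le>n. w n k * (f (x n k) - real (k choose i) / real (n choose i))\<bar>"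
          by (simp add: sum_subtractf right_diff_distrib)
        also have "\<dots> \<le> (\<Sum>k\<le>n. w n k * (e / 2))"
        proof (rule order_trans[OF sum_abs sum_mono])
          fix k assume "k \<in> {..n}"
          then have "\<bar>f (x n k) - real (k choose i) / real (n choose i)\<bar> \<le> e / 2"
            using N[of n k] n f01[OF x01[of k n]] by (simp add: x_def)
          then have "w n k * \<bar>f (x n k) - real (k choose i) / real (n choose i)\<bar> \<le> w n k * (e / 2)"
            by (intro mult_left_mono w_nonneg)
          then show "\<bar>w n k * (f (x n k) - real (k choose i) / real (n choose i))\<bar> \<le> w n k * (e / 2)"
            using w_nonneg[of n k] by (simp only: abs_mult abs_of_nonneg)
        qed
        also have "\<dots> < e"
          unfolding sum_distrib_right[symmetric] using w_sum[of n] \<open>0 < e\<close> by simp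
        finally show ?thesis .
      qed
      then show "\<exists>N. \<forall>n\<ge>N. norm ((\<Sum>k\<le>n. w n k * f (x n k)) - b i 0) < e"
        by auto
    qed
    then have "(\<lambda>n. \<Sum>k\<le>r n. w (r n) k * f (x (r n) k)) \<longlonglongrightarrow> b i 0"
      using LIMSEQ_subseq_LIMSEQ[OF _ r] unfolding o_def by blast
    ultimately have "(\<integral>t. f t \<partial>M) = b i 0"
      by (rule LIMSEQ_unique)
    moreover have "(\<integral>t. t ^ i * indicator {0..1} t \<partial>M) = (\<integral>t. f t \<partial>M)"
      by (rule integral_cong_AE) (use AE01 f01 in \<open>auto simp: f_def\<close>)
    ultimately show ?thesis by simp
  qed
  with M AE01 show ?thesis by blast
qed

text \<open>Divide by \<open>b 0 0\<close>. If that is zero, all \<open>b i 0\<close> vanish, since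
  \<open>rec\<close> and \<open>nonneg\<close> make them decrease in \<open>i\<close>.\<close>

theorem hausdorff_moment_problem:
  fixes b :: "nat \<Rightarrow> nat \<Rightarrow> real"
  assumes nonneg: "\<And>i j. 0 \<le> b i j" and rec: "\<And>i j. b i j = b (Suc i) j + b i (Suc j)"
  shows "\<exists>M. finite_measure M \<and> sets M = sets borel \<and> (AE t in M. t \<in> {0..1}) \<and>
    (\<forall>i. (\<integral>t. t ^ i * indicator {0..1} t \<partial>M) = b i 0)"
proof (cases "b 0 0 = 0")
  case True
  have "b i 0 = 0" for i
  proof (induction i)
    case (Suc i)
    then show ?case
      using rec[of i 0] nonneg[of "Suc i" 0] nonneg[of i 1] by simp
  qed (rule True)
  then show ?thesis
    by (intro exI[of _ "null_measure borel"]) (auto intro!: finite_measureI simp: eventually_ae_filter null_sets_def)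
next
  case False
  define c where "c = b 0 0"
  have c: "0 < c" using False nonneg[of 0 0] by (simp add: c_def)
  have "\<exists>M. real_distribution M \<and> (AE t in M. t \<in> {0..1}) \<and>
      (\<forall>i. (\<integral>t. t ^ i * indicator {0..1} t \<partial>M) = b i 0 / c)"
    using c by (intro hausdorff_moment_problem_normalised)
      (auto simp: nonneg c_def add_divide_distrib[symmetric] rec[symmetric])
  then obtain M where M: "real_distribution M" "AE t in M. t \<in> {0..1}"
    "\<And>i. (\<integral>t. t ^ i * indicator {0..1} t \<partial>M) = b i 0 / c"
    by blast
  interpret M: real_distribution M by fact
  show ?thesis
  proof (intro exI[of _ "density M (\<lambda>_. ennreal c)"] conjI allI)
    show "finite_measure (density M (\<lambda>_. ennreal c))"
      by (rule finite_measureI) (simp add: emeasure_density ennreal_mult_eq_top_iff)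
    show "AE t in density M (\<lambda>_. ennreal c). t \<in> {0..1}"
      using M(2) by (simp add: AE_density)
    fix i
    show "(\<integral>t. t ^ i * indicator {0..1} t \<partial>density M (\<lambda>_. ennreal c)) = b i 0"
      using c M(3)[of i] by (simp add: integral_density)
  qed simp
qed

section \<open>Functional calculus of a bounded positive operator\<close>

locale positive_operator =
  fixes B :: "'a::{real_inner, complete_space} \<Rightarrow> 'a" and m :: real
  assumes bounded_linear: "bounded_linear B"
    and symmetric: "B x \<bullet> y = x \<bullet> B y"
    and positive: "0 \<le> B x \<bullet> x"
    and upper: "B x \<bullet> x \<le> m * (x \<bullet> x)"
    and m_pos: "0 < m"
begin

sublocale B: bounded_linear B
  by (rule bounded_linear)

lemma funpow_linear: "linear (B ^^ k)"
proof (induction k)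
  case 0
  show ?case by (simp add: linear_iff)
next
  case (Suc k)
  show ?case using linear_compose[OF Suc B.linear] by (simp add: o_def)
qed

lemmas funpow_add = linear_add[OF funpow_linear] and funpow_diff = linear_diff[OF funpow_linear]
  and funpow_scale = linear_cmul[OF funpow_linear]

lemma funpow_symmetric: "(B ^^ k) x \<bullet> y = x \<bullet> (B ^^ k) y"
  by (induction k arbitrary: y) (simp_all add: symmetric funpow_swap1[symmetric])

section \<open>Positivity of the difference scheme of a rescaled operator\<close>

definition Bm :: "'a \<Rightarrow> 'a" where "Bm x = (1 / m) *\<^sub>R B x"
text \<open>\<open>Bm\<close> and \<open>Bc\<close> play the parts of \<open>t\<close> and
  \<open>1 - t\<close> in the moment problem on \<open>[0, 1]\<close>.\<close>

definition Bc :: "'a \<Rightarrow> 'a" where "Bc x = x - Bm x"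

lemma Bm_linear: "Bm (x + y) = Bm x + Bm y" "Bm (x - y) = Bm x - Bm y"
  by (simp_all add: Bm_def B.add B.diff scaleR_add_right scaleR_diff_right)

lemma Bm_symmetric: "Bm x \<bullet> y = x \<bullet> Bm y"
  by (simp add: Bm_def symmetric)

lemma Bc_symmetric: "Bc x \<bullet> y = x \<bullet> Bc y"
  by (simp add: Bc_def Bm_symmetric inner_diff_left inner_diff_right)

lemma Bm_Bc_commute: "Bm (Bc x) = Bc (Bm x)"
  by (simp add: Bc_def Bm_linear)

lemma funpow_Bm: "(Bm ^^ k) x = (1 / m ^ k) *\<^sub>R (B ^^ k) x"
  by (induction k) (simp_all add: Bm_def B.scaleR)

lemma funpow_Bm_diff: "(Bm ^^ k) (x - y) = (Bm ^^ k) x - (Bm ^^ k) y"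
  by (simp add: funpow_Bm funpow_diff scaleR_diff_right)

lemma funpow_Bm_Bc: "(Bm ^^ k) (Bc x) = Bc ((Bm ^^ k) x)"
  by (induction k) (simp_all add: Bm_Bc_commute)

lemma funpow_Bc_Bm: "(Bc ^^ k) (Bm x) = Bm ((Bc ^^ k) x)"
  by (induction k) (simp_all add: Bm_Bc_commute)

lemma Bm_nonneg: "0 \<le> Bm x \<bullet> x" and Bc_nonneg: "0 \<le> Bc x \<bullet> x"
  using positive[of x] upper[of x] m_pos
  by (simp_all add: Bm_def Bc_def inner_diff_left field_simps)

text \<open>From \<open>s (1 - s) = s^2 (1 - s) + s (1 - s)^2\<close>: the two terms are the form of
  \<open>Bc\<close> at \<open>Bm x\<close> and the form of \<open>Bm\<close> at \<open>Bc x\<close>.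
  This avoids square roots of operators.\<close>

lemma Bm_Bc_nonneg: "0 \<le> Bm (Bc x) \<bullet> x"
proof -
  have "Bm (Bc x) \<bullet> x = Bc (Bm x) \<bullet> Bm x + Bm (Bc x) \<bullet> Bc x"
  proof -
    have "Bm (Bc x) = Bm (Bc (Bm x)) + Bm (Bc (Bc x))"
      by (simp add: Bc_def Bm_linear)
    then have "Bm (Bc x) \<bullet> x = Bm (Bc (Bm x)) \<bullet> x + Bm (Bc (Bc x)) \<bullet> x"
      by (metis inner_add_left)
    then show ?thesis
      by (metis Bm_Bc_commute Bm_symmetric Bc_symmetric)
  qed
  then show ?thesis
    using Bm_nonneg[of "Bc x"] Bc_nonneg[of "Bm x"] by simp
qed

text \<open>Symmetry moves one of two equal factors onto the right-hand \<open>x\<close>, which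
  lowers an exponent by two; only exponents \<open>0\<close> and \<open>1\<close> remain.\<close>

lemma difference_scheme_nonneg: "0 \<le> (Bm ^^ i) ((Bc ^^ j) x) \<bullet> x"
proof (induction "i + j" arbitrary: i j x rule: less_induct)
  case less
  consider i' where "i = Suc (Suc i')" | j' where "j = Suc (Suc j')" | "i \<le> 1" "j \<le> 1"
    by (metis One_nat_def not0_implies_Suc not_less_eq_eq le_0_eq)
  then show ?case
  proof cases
    case (1 i')
    have "(Bm ^^ i) ((Bc ^^ j) x) \<bullet> x = (Bm ^^ i') ((Bc ^^ j) (Bm x)) \<bullet> Bm x"
      by (simp add: 1 funpow_Bc_Bm Bm_symmetric funpow_swap1[symmetric])
    then show ?thesis using less[of i' j] 1 by simp
  next
    case (2 j')
    have "(Bm ^^ i) ((Bc ^^ j) x) \<bullet> x = (Bm ^^ i) ((Bc ^^ j') (Bc x)) \<bullet> Bc x"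
      by (simp add: 2 funpow_Bm_Bc Bc_symmetric funpow_swap1[symmetric])
    then show ?thesis using less[of i j'] 2 by simp
  next
    case 3
    then have "i = 0 \<or> i = 1" "j = 0 \<or> j = 1" by auto
    then show ?thesis
      using Bm_nonneg[of x] Bc_nonneg[of x] Bm_Bc_nonneg[of x] by auto
  qed
qed

section \<open>Moment measures and their determinacy\<close>

lemma spectral_moment_measure:
  "\<exists>M. finite_measure M \<and> sets M = sets borel \<and> (AE t in M. t \<in> {0..m}) \<and>
    (\<forall>k. (\<integral>t. t ^ k * indicator {0..m} t \<partial>M) = (B ^^ k) x \<bullet> x)"
proof -
  have "\<exists>M. finite_measure M \<and> sets M = sets borel \<and> (AE t in M. t \<in> {0..1}) \<and>
    (\<forall>i. (\<integral>t. t ^ i * indicator {0..1} t \<partial>M) = (Bm ^^ i) ((Bc ^^ 0) x) \<bullet> x)"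
  proof (rule hausdorff_moment_problem)
    fix i j
    have "(Bm ^^ i) ((Bc ^^ Suc j) x) = (Bm ^^ i) ((Bc ^^ j) x) - (Bm ^^ Suc i) ((Bc ^^ j) x)"
      by (simp add: Bc_def[of "(Bc ^^ j) x"] funpow_Bm_diff funpow_swap1[symmetric])
    then show "(Bm ^^ i) ((Bc ^^ j) x) \<bullet> x =
        (Bm ^^ Suc i) ((Bc ^^ j) x) \<bullet> x + (Bm ^^ i) ((Bc ^^ Suc j) x) \<bullet> x"
      by (simp only: inner_diff_left)
  qed (rule difference_scheme_nonneg)
  then obtain M where M: "finite_measure M" "sets M = sets borel" "AE t in M. t \<in> {0..1}"
    "\<And>i. (\<integral>t. t ^ i * indicator {0..1} t \<partial>M) = (Bm ^^ i) x \<bullet> x"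
    by auto
  interpret finite_measure M by fact
  note [measurable_cong] = M(2)
  show ?thesis
  \<comment> \<open>Undoes the rescaling: the \<open>k\<close>-th moment gains the factor
    \<open>m^k\<close> that \<open>Bm\<close> had lost.\<close>
  proof (intro exI[of _ "distr M borel (\<lambda>t. m * t)"] conjI allI)
    show "finite_measure (distr M borel (\<lambda>t. m * t))"
      by (rule finite_measure_distr) measurable
    show "AE t in distr M borel (\<lambda>t. m * t). t \<in> {0..m}"
      using M(3) m_pos by (subst AE_distr_iff) (auto simp: mult_left_le)
    fix k
    have "(\<integral>t. t ^ k * indicator {0..m} t \<partial>distr M borel (\<lambda>t. m * t)) =
        (\<integral>t. m ^ k * (t ^ k * indicator {0..1} t) \<partial>M)"
      using m_pos by (subst integral_distr)
        (auto simp: indicator_def power_mult_distrib zero_le_mult_iff mult.assoc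
          intro!: Bochner_Integration.integral_cong simp del: integral_mult_right_zero)
    then show "(\<integral>t. t ^ k * indicator {0..m} t \<partial>distr M borel (\<lambda>t. m * t)) = (B ^^ k) x \<bullet> x"
      using m_pos by (simp add: M(4) funpow_Bm)
  qed simp
qed

text \<open>The choices for different \<open>x\<close> are unrelated a priori;
  \<open>carried_eqI\<close> is what ties them together.\<close>

definition moment_measure :: "'a \<Rightarrow> real measure" where
  "moment_measure x = (SOME M. finite_measure M \<and> sets M = sets borel \<and> (AE t in M. t \<in> {0..m}) \<and>
    (\<forall>k. (\<integral>t. t ^ k * indicator {0..m} t \<partial>M) = (B ^^ k) x \<bullet> x))"

lemma moment_measure:
  shows moment_measure_finite: "finite_measure (moment_measure x)"
    and moment_measure_sets: "sets (moment_measure x) = sets borel"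
    and moment_measure_carrier: "AE t in moment_measure x. t \<in> {0..m}"
    and moment_measure_moment:
      "(\<integral>t. t ^ k * indicator {0..m} t \<partial>moment_measure x) = (B ^^ k) x \<bullet> x"
  using someI_ex[OF spectral_moment_measure[of x]] unfolding moment_measure_def[symmetric] by blast+

text \<open>Signed measures concentrated on \<open>[0, m]\<close>; compactness of the interval makes
  their moments decisive.\<close>

definition carried :: "((real \<Rightarrow> real) \<Rightarrow> real) \<Rightarrow> bool" where
  "carried \<Lambda> \<longleftrightarrow> normal_functional \<Lambda> \<and>
    (\<forall>\<phi>\<in>bounded_borel. (\<forall>t\<in>{0..m}. \<phi> t = 0) \<longrightarrow> \<Lambda> \<phi> = 0)"

lemma carried_normal: "carried \<Lambda> \<Longrightarrow> normal_functional \<Lambda>"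
  by (simp add: carried_def)

lemma carried_add: "carried \<Lambda> \<Longrightarrow> carried \<Lambda>' \<Longrightarrow> carried (\<lambda>\<phi>. \<Lambda> \<phi> + \<Lambda>' \<phi>)"
  by (simp add: carried_def normal_functional_add)

lemma carried_diff: "carried \<Lambda> \<Longrightarrow> carried \<Lambda>' \<Longrightarrow> carried (\<lambda>\<phi>. \<Lambda> \<phi> - \<Lambda>' \<phi>)"
  by (simp add: carried_def normal_functional_diff)

lemma carried_cmult: "carried \<Lambda> \<Longrightarrow> carried (\<lambda>\<phi>. c * \<Lambda> \<phi>)"
  by (simp add: carried_def normal_functional_cmult)

lemma carried_mult: "carried \<Lambda> \<Longrightarrow> g \<in> bounded_borel \<Longrightarrow> carried (\<lambda>\<phi>. \<Lambda> (\<lambda>x. \<phi> x * g x))"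
  by (simp add: carried_def normal_functional_mult)

lemma carried_moment_measure: "carried (\<lambda>\<phi>. \<integral>t. \<phi> t \<partial>moment_measure x)"
  unfolding carried_def
proof (intro conjI ballI impI normal_functional_integral moment_measure)
  fix \<phi> assume "\<phi> \<in> bounded_borel" "\<forall>t\<in>{0..m}. \<phi> t = 0"
  then show "(\<integral>t. \<phi> t \<partial>moment_measure x) = 0"
    by (intro integral_eq_zero_AE) (rule eventually_mono[OF moment_measure_carrier], simp)
qed

lemma carried_eqI:
  assumes "carried \<Lambda>" "carried \<Lambda>'"
    and "\<And>k. \<Lambda> (\<lambda>t. t ^ k * indicator {0..m} t) = \<Lambda>' (\<lambda>t. t ^ k * indicator {0..m} t)"
    and "\<phi> \<in> bounded_borel"
  shows "\<Lambda> \<phi> = \<Lambda>' \<phi>"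
proof -
  have "carried (\<lambda>\<phi>. \<Lambda> \<phi> - \<Lambda>' \<phi>)"
    using assms by (intro carried_diff)
  then have "normal_functional (\<lambda>\<phi>. \<Lambda> \<phi> - \<Lambda>' \<phi>)"
    "\<And>\<phi>. \<phi> \<in> bounded_borel \<Longrightarrow> (\<And>t. t \<in> {0..m} \<Longrightarrow> \<phi> t = 0) \<Longrightarrow> \<Lambda> \<phi> - \<Lambda>' \<phi> = 0"
    unfolding carried_def by blast+
  moreover have "\<Lambda> (\<lambda>t. t ^ k * indicator {0..m} t) - \<Lambda>' (\<lambda>t. t ^ k * indicator {0..m} t) = 0" for k
    using assms(3)[of k] by linarith
  ultimately have "\<Lambda> \<phi> - \<Lambda>' \<phi> = 0"
    using assms(4) by (rule normal_functional_eq_zero_if_moments)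
  then show ?thesis by simp
qed

section \<open>Polarised moment measures\<close>

definition polar :: "'a \<Rightarrow> 'a \<Rightarrow> (real \<Rightarrow> real) \<Rightarrow> real" where
  "polar x y \<phi> = (1/4) * ((\<integral>t. \<phi> t \<partial>moment_measure (x + y)) - (\<integral>t. \<phi> t \<partial>moment_measure (x - y)))"

lemma carried_polar: "carried (polar x y)"
  unfolding polar_def by (intro carried_cmult carried_diff carried_moment_measure)

lemma polar_moment: "polar x y (\<lambda>t. t ^ k * indicator {0..m} t) = (B ^^ k) x \<bullet> y"
proof -
  have "(B ^^ k) y \<bullet> x = (B ^^ k) x \<bullet> y"
    by (metis funpow_symmetric inner_commute)
  then show ?thesis
    by (simp add: polar_def moment_measure_moment funpow_add funpow_diff inner_add_left inner_add_right
        inner_diff_left inner_diff_right)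
qed

lemma clipped_power_bounded_borel: "(\<lambda>t. t ^ k * indicator {0..m} t) \<in> bounded_borel"
  using m_pos by (intro bounded_borelI[where K = "m ^ k"]) (auto simp: indicator_def power_mono power_abs)

text \<open>The moments \<open>(B^k x, y)\<close> are additive in \<open>x\<close>, and determinacy
  passes this on to all bounded Borel functions. Scaling, symmetry and \<open>polar_self\<close> are
  obtained in the same way.\<close>

lemma polar_add_left:
  assumes "\<phi> \<in> bounded_borel" shows "polar (x + x') y \<phi> = polar x y \<phi> + polar x' y \<phi>"
  by (rule carried_eqI[of "polar (x + x') y" "\<lambda>\<phi>. polar x y \<phi> + polar x' y \<phi>"])
    (simp_all add: assms carried_polar carried_add polar_moment funpow_add inner_add_left)

lemma polar_scale_left:
  assumes "\<phi> \<in> bounded_borel" shows "polar (c *\<^sub>R x) y \<phi> = c * polar x y \<phi>"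
  by (rule carried_eqI[of "polar (c *\<^sub>R x) y" "\<lambda>\<phi>. c * polar x y \<phi>"])
    (simp_all add: assms carried_polar carried_cmult polar_moment funpow_scale)

lemma polar_commute:
  assumes "\<phi> \<in> bounded_borel" shows "polar x y \<phi> = polar y x \<phi>"
  by (rule carried_eqI[of "polar x y" "polar y x"])
    (simp_all add: assms carried_polar polar_moment, metis funpow_symmetric inner_commute)

lemma polar_self:
  assumes "\<phi> \<in> bounded_borel" shows "polar x x \<phi> = (\<integral>t. \<phi> t \<partial>moment_measure x)"
  by (rule carried_eqI[of "polar x x" "\<lambda>\<phi>. \<integral>t. \<phi> t \<partial>moment_measure x"])
    (simp_all add: assms carried_polar carried_moment_measure polar_moment moment_measure_moment)

lemma moment_measure_total: "measure (moment_measure x) UNIV = (norm x)\<^sup>2"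
proof -
  have sp: "space (moment_measure x) = UNIV"
    using sets_eq_imp_space_eq[OF moment_measure_sets[of x]] by simp
  have "(\<integral>t. t ^ 0 * indicator {0..m} t \<partial>moment_measure x) = (\<integral>t. 1 \<partial>moment_measure x)"
    using moment_measure_carrier[of x]
    by (intro integral_cong_AE)
      (auto simp: indicator_def measurable_cong_sets[OF moment_measure_sets refl] elim!: eventually_mono)
  then show ?thesis
    using moment_measure_moment[where k = 0 and x = x] by (simp add: power2_norm_eq_inner sp)
qed

lemma moment_measure_integral_bound:
  assumes "\<phi> \<in> bounded_borel" "\<And>t. \<bar>\<phi> t\<bar> \<le> K"
  shows "\<bar>\<integral>t. \<phi> t \<partial>moment_measure x\<bar> \<le> K * (norm x)\<^sup>2"
proof -
  interpret finite_measure "moment_measure x" by (rule moment_measure_finite)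
  have sp: "space (moment_measure x) = UNIV"
    using sets_eq_imp_space_eq[OF moment_measure_sets[of x]] by simp
  have int: "integrable (moment_measure x) \<phi>"
    using assms by (intro integrable_bounded_borel moment_measure)
  have "\<bar>\<integral>t. \<phi> t \<partial>moment_measure x\<bar> \<le> (\<integral>t. \<bar>\<phi> t\<bar> \<partial>moment_measure x)"
    by (rule integral_abs_bound)
  also have "\<dots> \<le> (\<integral>t. K \<partial>moment_measure x)"
    using int assms(2) by (intro integral_mono) auto
  finally show ?thesis by (simp add: sp moment_measure_total mult.commute)
qed

lemma polar_scale_right:
  assumes "\<phi> \<in> bounded_borel" shows "polar x (c *\<^sub>R y) \<phi> = c * polar x y \<phi>"
  using assms by (metis polar_commute polar_scale_left)

text \<open>For unit vectors the two integral bounds add up to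
  \<open>K (|u + v|^2 + |u - v|^2) / 4 = K\<close>, by the parallelogram law; homogeneity gives the
  rest.\<close>

lemma polar_bound:
  assumes \<phi>: "\<phi> \<in> bounded_borel" and K: "\<And>t. \<bar>\<phi> t\<bar> \<le> K"
  shows "\<bar>polar x y \<phi>\<bar> \<le> K * norm x * norm y"
proof (cases "x = 0 \<or> y = 0")
  case True
  then show ?thesis
    using polar_scale_left[OF \<phi>, of 0 x y] polar_scale_right[OF \<phi>, of x 0 y] by auto
next
  case False
  define u where "u = (1 / norm x) *\<^sub>R x"
  define v where "v = (1 / norm y) *\<^sub>R y"
  have n: "norm u = 1" "norm v = 1" using False by (simp_all add: u_def v_def)
  have "\<bar>polar u v \<phi>\<bar> \<le> (1/4) * (K * (norm (u + v))\<^sup>2 + K * (norm (u - v))\<^sup>2)"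
    using moment_measure_integral_bound[OF assms, of "u + v"] moment_measure_integral_bound[OF assms, of "u - v"]
    by (simp add: polar_def)
  also have "\<dots> = K"
    using norm_add_sub_squares[of u v] n by (simp add: distrib_left[symmetric])
  finally have "\<bar>polar u v \<phi>\<bar> \<le> K" .
  moreover have "x = norm x *\<^sub>R u" "y = norm y *\<^sub>R v"
    using False by (simp_all add: u_def v_def)
  then have "polar x y \<phi> = norm x * norm y * polar u v \<phi>"
    using polar_scale_left[OF \<phi>, of "norm x" u y] polar_scale_right[OF \<phi>, of u "norm y" v] by simp
  ultimately show ?thesis
    by (simp add: abs_mult) (metis mult.commute mult_left_mono norm_ge_zero mult_nonneg_nonneg mult.assoc)
qed

section \<open>Bounded Borel functions of \<open>B\<close>\<close>

definition calc :: "(real \<Rightarrow> real) \<Rightarrow> 'a \<Rightarrow> 'a" where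
  "calc \<phi> x = (SOME z. \<forall>y. polar x y \<phi> = z \<bullet> y)"

lemma calc_inner:
  assumes \<phi>: "\<phi> \<in> bounded_borel"
  shows "calc \<phi> x \<bullet> y = polar x y \<phi>"
proof -
  obtain K where K: "\<And>t. \<bar>\<phi> t\<bar> \<le> K"
    using \<phi> by (auto simp: bounded_borel_def)
  have "bounded_linear (\<lambda>y. polar x y \<phi>)"
  proof (rule bounded_linear_intro[where K = "K * norm x"])
    show "polar x (y + y') \<phi> = polar x y \<phi> + polar x y' \<phi>" for y y'
      using polar_add_left[OF \<phi>, of y y' x] by (simp add: polar_commute[OF \<phi>, of x])
    show "norm (polar x y \<phi>) \<le> norm y * (K * norm x)" for y
      using polar_bound[OF \<phi> K, of x y] by (simp add: mult_ac)
  qed (simp add: polar_scale_right[OF \<phi>])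
  then have "\<exists>z. \<forall>y. polar x y \<phi> = z \<bullet> y"
    by (rule riesz_representation)
  then have "\<forall>y. polar x y \<phi> = calc \<phi> x \<bullet> y"
    unfolding calc_def by (rule someI_ex)
  then show ?thesis by simp
qed

lemma inner_eqI: "(\<And>y. u \<bullet> y = v \<bullet> y) \<Longrightarrow> u = (v::'a)"
  using vector_eq_rdot[of u v] by blast

lemma calc_inner_self:
  "\<phi> \<in> bounded_borel \<Longrightarrow> calc \<phi> x \<bullet> x = (\<integral>t. \<phi> t \<partial>moment_measure x)"
  by (simp add: calc_inner polar_self)

lemma calc_symmetric: "\<phi> \<in> bounded_borel \<Longrightarrow> calc \<phi> x \<bullet> y = x \<bullet> calc \<phi> y"
  by (metis calc_inner inner_commute polar_commute)

lemma calc_bounded_linear: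
  assumes \<phi>: "\<phi> \<in> bounded_borel"
  shows "bounded_linear (calc \<phi>)"
proof -
  obtain K where K: "\<And>t. \<bar>\<phi> t\<bar> \<le> K"
    using \<phi> by (auto simp: bounded_borel_def)
  have K0: "0 \<le> K" using K[of 0] by linarith
  show ?thesis
  proof (rule bounded_linear_intro[where K = K])
    show "calc \<phi> (x + y) = calc \<phi> x + calc \<phi> y" for x y
      by (rule inner_eqI) (simp add: calc_inner \<phi> polar_add_left inner_add_left)
    show "calc \<phi> (c *\<^sub>R x) = c *\<^sub>R calc \<phi> x" for c x
      by (rule inner_eqI) (simp add: calc_inner \<phi> polar_scale_left)
    show "norm (calc \<phi> x) \<le> norm x * K" for x
    proof -
      have "norm (calc \<phi> x) * norm (calc \<phi> x) = polar x (calc \<phi> x) \<phi>"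
        using calc_inner[OF \<phi>, of x "calc \<phi> x"]
        by (simp add: power2_norm_eq_inner flip: power2_eq_square)
      then have "norm (calc \<phi> x) * norm (calc \<phi> x) \<le> (norm x * K) * norm (calc \<phi> x)"
        using polar_bound[OF \<phi> K, of x "calc \<phi> x"] by (simp only: mult.commute[of K])
      then show ?thesis
        using K0 by (cases "norm (calc \<phi> x) = 0") (auto simp: mult_le_cancel_right)
    qed
  qed
qed

lemma calc_power: "calc (\<lambda>t. t ^ k * indicator {0..m} t) x = (B ^^ k) x"
  by (rule inner_eqI) (simp add: calc_inner clipped_power_bounded_borel polar_moment)

lemma calc_cong:
  assumes "\<phi> \<in> bounded_borel" "\<psi> \<in> bounded_borel" "\<And>t. t \<in> {0..m} \<Longrightarrow> \<phi> t = \<psi> t"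
  shows "calc \<phi> x = calc \<psi> x"
proof (rule inner_eqI)
  fix y
  have "polar x y (\<lambda>t. \<phi> t - \<psi> t) = 0"
    using carried_polar[of x y] assms by (simp add: carried_def)
  then show "calc \<phi> x \<bullet> y = calc \<psi> x \<bullet> y"
    using normal_functionalD(1)[OF carried_normal[OF carried_polar[of x y]], of "\<lambda>t. \<phi> t - \<psi> t" \<psi>] assms
    by (simp add: calc_inner)
qed

lemma calc_one: "calc (\<lambda>_. 1) x = x"
  using calc_cong[of "\<lambda>_. 1" "\<lambda>t. t ^ 0 * indicator {0..m} t" x] calc_power[of 0 x]
    clipped_power_bounded_borel[of 0] by simp

lemma calc_diff:
  assumes "\<phi> \<in> bounded_borel" "\<psi> \<in> bounded_borel"
  shows "calc (\<lambda>t. \<phi> t - \<psi> t) x = calc \<phi> x - calc \<psi> x"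
proof (rule inner_eqI)
  fix y
  show "calc (\<lambda>t. \<phi> t - \<psi> t) x \<bullet> y = (calc \<phi> x - calc \<psi> x) \<bullet> y"
    using normal_functionalD(1)[OF carried_normal[OF carried_polar[of x y]], of "\<lambda>t. \<phi> t - \<psi> t" \<psi>] assms
    by (simp add: calc_inner inner_diff_left)
qed

text \<open>Two comparisons of moments: the first treats a power times an arbitrary
  \<open>\<psi>\<close>, the second replaces the power by an arbitrary
  \<open>\<phi>\<close>.\<close>

lemma calc_mult:
  assumes \<phi>: "\<phi> \<in> bounded_borel" and \<psi>: "\<psi> \<in> bounded_borel"
  shows "calc (\<lambda>t. \<phi> t * \<psi> t) x = calc \<phi> (calc \<psi> x)"
proof (rule inner_eqI)
  fix y
  have power: "polar x y (\<lambda>t. (t ^ k * indicator {0..m} t) * \<psi> t) = polar x ((B ^^ k) y) \<psi>" for k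
  proof -
    have "polar x y (\<lambda>t. \<psi> t * (t ^ k * indicator {0..m} t)) = polar x ((B ^^ k) y) \<psi>"
    proof (rule carried_eqI[where \<Lambda> = "\<lambda>\<psi>. polar x y (\<lambda>t. \<psi> t * (t ^ k * indicator {0..m} t))"
          and \<Lambda>' = "polar x ((B ^^ k) y)"])
      fix j
      have "(\<lambda>t. t ^ j * indicator {0..m} t * (t ^ k * indicator {0..m} t)) =
          (\<lambda>t. t ^ (k + j) * indicator {0..m} t :: real)"
        by (auto simp: indicator_def power_add)
      then show "polar x y (\<lambda>t. t ^ j * indicator {0..m} t * (t ^ k * indicator {0..m} t)) =
          polar x ((B ^^ k) y) (\<lambda>t. t ^ j * indicator {0..m} t)"
        by (simp add: polar_moment funpow_add[symmetric] funpow_symmetric[of k, symmetric] Nat.funpow_add)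
    qed (simp_all add: carried_mult[OF carried_polar clipped_power_bounded_borel] carried_polar \<psi>)
    then show ?thesis by (simp add: mult.commute)
  qed
  have "polar x y (\<lambda>t. \<phi> t * \<psi> t) = polar (calc \<psi> x) y \<phi>"
  proof (rule carried_eqI[where \<Lambda> = "\<lambda>\<phi>. polar x y (\<lambda>t. \<phi> t * \<psi> t)" and \<Lambda>' = "polar (calc \<psi> x) y"])
    fix k
    show "polar x y (\<lambda>t. t ^ k * indicator {0..m} t * \<psi> t) =
        polar (calc \<psi> x) y (\<lambda>t. t ^ k * indicator {0..m} t)"
      by (simp add: power polar_moment funpow_symmetric calc_inner \<psi>)
  qed (simp_all add: carried_mult[OF carried_polar \<psi>] carried_polar \<phi>)
  then show "calc (\<lambda>t. \<phi> t * \<psi> t) x \<bullet> y = calc \<phi> (calc \<psi> x) \<bullet> y"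
    by (simp add: calc_inner \<phi> \<psi>)
qed

lemma norm_calc_squared:
  assumes "\<phi> \<in> bounded_borel"
  shows "(norm (calc \<phi> x))\<^sup>2 = (\<integral>t. (\<phi> t)\<^sup>2 \<partial>moment_measure x)"
proof -
  have "(norm (calc \<phi> x))\<^sup>2 = calc \<phi> (calc \<phi> x) \<bullet> x"
    by (simp add: power2_norm_eq_inner calc_symmetric[OF assms, of "calc \<phi> x"])
  then show ?thesis
    using assms by (simp add: calc_mult[symmetric] calc_inner_self power2_eq_square)
qed

text \<open>\<open>norm_calc_squared\<close> turns the distance of the vectors into the
  \<open>L^2\<close> distance of the functions, so dominated convergence yields strong
  convergence.\<close>

lemma calc_tendsto:
  assumes F: "bounded_limit F \<phi>"
  shows "(\<lambda>n. calc (F n) x) \<longlonglongrightarrow> calc \<phi> x"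
proof -
  note b = bounded_limit_bounded_borel[OF F]
  obtain K where K: "\<And>n t. \<bar>F n t\<bar> \<le> K" and lim: "\<And>t. (\<lambda>n. F n t) \<longlonglongrightarrow> \<phi> t"
    using F unfolding bounded_limit_def by blast
  have "bounded_limit (\<lambda>n t. (F n t - \<phi> t)\<^sup>2) (\<lambda>_. 0)"
    unfolding bounded_limit_def
  proof (intro conjI allI exI)
    fix n t
    show "(\<lambda>n. (F n t - \<phi> t)\<^sup>2) \<longlonglongrightarrow> 0"
      using tendsto_power[OF LIM_zero[OF lim[of t]], of 2] by simp
    show "(\<lambda>t. (F n t - \<phi> t)\<^sup>2) \<in> borel_measurable borel"
      using b by (auto dest!: bounded_borel_measurable)
    have "\<bar>\<phi> t\<bar> \<le> K"
      by (rule LIMSEQ_le_const2[OF tendsto_rabs[OF lim]]) (use K in auto)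
    then have "\<bar>F n t - \<phi> t\<bar> \<le> 2 * K"
      using K[of n t] by linarith
    then show "\<bar>(F n t - \<phi> t)\<^sup>2\<bar> \<le> (2 * K)\<^sup>2"
      using power_mono[of "\<bar>F n t - \<phi> t\<bar>" "2 * K" 2] by simp
  qed
  then have "(\<lambda>n. \<integral>t. (F n t - \<phi> t)\<^sup>2 \<partial>moment_measure x) \<longlonglongrightarrow> (\<integral>t. 0 \<partial>moment_measure x)"
    by (rule normal_functionalD(3)[OF carried_normal[OF carried_moment_measure]])
  then have "(\<lambda>n. (norm (calc (F n) x - calc \<phi> x))\<^sup>2) \<longlonglongrightarrow> 0"
    using b by (simp add: calc_diff[symmetric] norm_calc_squared)
  then have "(\<lambda>n. norm (calc (F n) x - calc \<phi> x)) \<longlonglongrightarrow> 0"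
    using tendsto_real_sqrt[of "\<lambda>n. (norm (calc (F n) x - calc \<phi> x))\<^sup>2" 0] by simp
  then show ?thesis
    using LIM_zero_cancel tendsto_norm_zero_iff by blast
qed

end

section \<open>Projection-valued measures\<close>

locale spectral_projections =
  fixes E :: "real set \<Rightarrow> 'a::real_inner \<Rightarrow> 'a"
  assumes pvm: "projection_valued_measure E"
begin

lemma
  assumes "S \<in> sets borel"
  shows bounded_linear: "bounded_linear (E S)"
    and symmetric: "E S x \<bullet> y = x \<bullet> E S y"
  using pvm assms unfolding projection_valued_measure_def by blast+

lemma Int: "S \<in> sets borel \<Longrightarrow> S' \<in> sets borel \<Longrightarrow> E S (E S' x) = E (S \<inter> S') x"
  using pvm unfolding projection_valued_measure_def by simp

lemma UNIV [simp]: "E UNIV x = x"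
  using pvm unfolding projection_valued_measure_def by blast

lemma sums: "range F \<subseteq> sets borel \<Longrightarrow> disjoint_family F \<Longrightarrow> (\<lambda>n. E (F n) x) sums E (\<Union>n. F n) x"
  using pvm unfolding projection_valued_measure_def by blast

text \<open>The empty set is a disjoint union of infinitely many copies of itself, and a convergent
  series with constant terms has zero terms.\<close>

lemma empty [simp]: "E {} x = 0"
proof -
  have "(\<lambda>n::nat. E {} x) sums E {} x"
    using sums[of "\<lambda>_. {}" x] by (simp add: disjoint_family_on_def)
  then have "(\<lambda>n::nat. E {} x) \<longlonglongrightarrow> 0"
    by (intro summable_LIMSEQ_zero) (rule sums_summable)
  then show ?thesis by (simp add: LIMSEQ_const_iff)
qed

lemma inner_eq_norm: "S \<in> sets borel \<Longrightarrow> x \<bullet> E S x = (norm (E S x))\<^sup>2"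
  by (simp add: power2_norm_eq_inner symmetric[of S x "E S x"] Int)

lemma
  shows sets_scalar_measure [simp, measurable_cong]: "sets (scalar_measure E h) = sets borel"
    and space_scalar_measure [simp]: "space (scalar_measure E h) = UNIV"
proof -
  have "sigma_sets UNIV (sets borel) = sets (borel :: real measure)"
    by (metis sets.sigma_sets_eq space_borel)
  then show "sets (scalar_measure E h) = sets borel"
    by (simp add: scalar_measure_def sets_measure_of_conv)
  then show "space (scalar_measure E h) = UNIV"
    using sets_eq_imp_space_eq[of "scalar_measure E h" borel] by simp
qed

lemma emeasure_scalar_measure:
  assumes "S \<in> sets borel"
  shows "emeasure (scalar_measure E h) S = ennreal ((norm (E S h))\<^sup>2)"
proof -
  have "emeasure (scalar_measure E h) S = ennreal (h \<bullet> E S h)"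
  proof (rule emeasure_measure_of[OF scalar_measure_def])
    show "countably_additive (sets (scalar_measure E h)) (\<lambda>S. ennreal (h \<bullet> E S h))"
      unfolding countably_additive_def
    proof (intro allI impI)
      fix F :: "nat \<Rightarrow> real set"
      assume F: "range F \<subseteq> sets (scalar_measure E h)" "disjoint_family F"
      then have "(\<lambda>n. h \<bullet> E (F n) h) sums (h \<bullet> E (\<Union>n. F n) h)"
        by (intro bounded_linear.sums[OF bounded_linear_inner_right] sums) simp_all
      moreover have "0 \<le> h \<bullet> E (F n) h" for n
        using F by (subst inner_eq_norm) auto
      ultimately show "(\<Sum>i. ennreal (h \<bullet> E (F i) h)) = ennreal (h \<bullet> E (\<Union>i. F i) h)"
        by (rule suminf_ennreal_eq[rotated])
    qed
  qed (use assms in \<open>auto simp: positive_def\<close>)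
  then show ?thesis using assms by (simp add: inner_eq_norm)
qed

lemma finite_scalar_measure: "finite_measure (scalar_measure E h)"
  by (rule finite_measureI) (simp add: emeasure_scalar_measure)

lemma measure_scalar_measure: "S \<in> sets borel \<Longrightarrow> measure (scalar_measure E h) S = (norm (E S h))\<^sup>2"
  by (simp add: measure_def emeasure_scalar_measure)

end

section \<open>The spectral theorem for the inverse of a bounded injective positive operator\<close>

locale injective_positive_operator = positive_operator +
  assumes injective: "B x = 0 \<Longrightarrow> x = 0"
begin

text \<open>As \<open>inverse 0 = 0\<close>, a mass of \<open>B\<close> at \<open>0\<close> would be
  sent to \<open>0\<close> instead of infinity; injectivity excludes it in
  \<open>calc_indicator_0\<close>.\<close>

definition proj :: "real set \<Rightarrow> 'a \<Rightarrow> 'a" where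
  "proj S = calc (indicator (inverse -` S))"

lemma vimage_inverse_borel [simp]: "S \<in> sets borel \<Longrightarrow> inverse -` S \<in> sets (borel :: real measure)"
  using measurable_sets_borel[of "inverse :: real \<Rightarrow> real" borel S] by simp

lemma projection_valued_measure_proj: "projection_valued_measure proj"
  unfolding projection_valued_measure_def
proof (intro conjI ballI allI impI)
  fix S S' :: "real set" and x y assume S: "S \<in> sets borel" and S': "S' \<in> sets borel"
  show "bounded_linear (proj S)"
    using S by (simp add: proj_def calc_bounded_linear)
  show "proj S x \<bullet> y = x \<bullet> proj S y"
    using S by (simp add: proj_def calc_symmetric)
  show "proj (S \<inter> S') x = proj S (proj S' x)"
    using S S' calc_mult[of "indicator (inverse -` S)" "indicator (inverse -` S')" x]
    by (simp add: proj_def indicator_inter_arith[symmetric])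
next
  fix x
  have "indicator UNIV = (\<lambda>_. 1 :: real)" by auto
  then show "proj UNIV x = x"
    by (simp add: proj_def calc_one)
next
  fix F :: "nat \<Rightarrow> real set" and x
  assume F: "range F \<subseteq> sets borel" and disj: "disjoint_family F"
  define G where "G n = inverse -` F n" for n
  have G: "G n \<in> sets borel" for n
    using F by (auto simp: G_def)
  have ind: "(\<Sum>i<n. indicator (G i) t) = (indicator (\<Union>i<n. G i) t :: real)" for n t
    using disj by (intro indicator_UN_disjoint[symmetric]) (auto simp: disjoint_family_on_def G_def)
  have "bounded_limit (\<lambda>n. indicator (\<Union>i<n. G i)) (indicator (\<Union>i. G i))"
    unfolding bounded_limit_def
  proof (intro conjI allI exI)
    fix n t
    show "\<bar>indicator (\<Union>i<n. G i) t\<bar> \<le> (1::real)"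
      by (simp add: indicator_def)
    show "(\<lambda>n. indicator (\<Union>i<n. G i) t) \<longlonglongrightarrow> (indicator (\<Union>i. G i) t :: real)"
      by (rule LIMSEQ_indicator_UN)
  qed (use G in auto)
  then have "(\<lambda>n. calc (indicator (\<Union>i<n. G i)) x) \<longlonglongrightarrow> calc (indicator (\<Union>i. G i)) x"
    by (rule calc_tendsto)
  moreover have "calc (indicator (\<Union>i<n. G i)) x = (\<Sum>i<n. calc (indicator (G i)) x)" for n
  proof (rule inner_eqI)
    fix y
    have "polar x y (\<lambda>t. \<Sum>i<n. indicator (G i) t) = (\<Sum>i<n. polar x y (indicator (G i)))"
      using G by (intro normal_functional_sum carried_normal carried_polar) auto
    then show "calc (indicator (\<Union>i<n. G i)) x \<bullet> y = (\<Sum>i<n. calc (indicator (G i)) x) \<bullet> y"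
      using G by (simp add: ind calc_inner inner_sum_left)
  qed
  moreover have "inverse -` (\<Union>n. F n) = (\<Union>n. G n)"
    by (auto simp: G_def)
  ultimately show "(\<lambda>n. proj (F n) x) sums proj (\<Union>n. F n) x"
    by (simp add: sums_def proj_def G_def)
qed

sublocale proj: spectral_projections proj
  by standard (rule projection_valued_measure_proj)

lemma emeasure_moment_measure:
  assumes "S \<in> sets borel"
  shows "emeasure (moment_measure x) S = ennreal ((norm (calc (indicator S) x))\<^sup>2)"
proof -
  interpret finite_measure "moment_measure x" by (rule moment_measure_finite)
  have sp: "space (moment_measure x) = UNIV"
    using sets_eq_imp_space_eq[OF moment_measure_sets[of x]] by simp
  have "(norm (calc (indicator S) x))\<^sup>2 = (\<integral>t. indicator S t \<partial>moment_measure x)"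
    using norm_calc_squared[of "indicator S" x] assms
    by (simp add: power2_eq_square indicator_inter_arith[symmetric])
  then show ?thesis
    using assms by (simp add: emeasure_eq_measure sp moment_measure_sets)
qed

lemma scalar_measure_proj: "scalar_measure proj h = distr (moment_measure h) borel inverse"
proof (rule measure_eqI)
  fix S assume "S \<in> sets (scalar_measure proj h)"
  then have S: "S \<in> sets borel" by simp
  have sp: "space (moment_measure h) = UNIV"
    using sets_eq_imp_space_eq[OF moment_measure_sets[of h]] by simp
  have "emeasure (distr (moment_measure h) borel inverse) S = emeasure (moment_measure h) (inverse -` S)"
    using S by (subst emeasure_distr)
      (simp_all add: sp measurable_cong_sets[OF moment_measure_sets refl])
  then show "emeasure (scalar_measure proj h) S = emeasure (distr (moment_measure h) borel inverse) S"
    using S by (simp add: proj.emeasure_scalar_measure emeasure_moment_measure proj_def)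
qed simp

lemma identity_bounded_borel: "(\<lambda>t. t * indicator {0..m} t) \<in> bounded_borel"
  using clipped_power_bounded_borel[of 1] by simp

lemma calc_identity: "calc (\<lambda>t. t * indicator {0..m} t) x = B x"
  using calc_power[of 1 x] by simp

lemma calc_zero: "calc (\<lambda>_. 0) x = 0"
  using norm_calc_squared[of "\<lambda>_. 0" x] by simp

text \<open>Applying the indicator of \<open>S\<close> to \<open>B x\<close> amounts to applying
  \<open>t\<close> cut to \<open>S\<close> to \<open>x\<close>, whose squared norm is the integral
  of \<open>t^2\<close> over \<open>S\<close>.\<close>

lemma moment_measure_image: "moment_measure (B x) = density (moment_measure x) (\<lambda>t. ennreal (t\<^sup>2))"
proof (rule measure_eqI)
  note [measurable_cong] = moment_measure_sets
  show "sets (moment_measure (B x)) = sets (density (moment_measure x) (\<lambda>t. ennreal (t\<^sup>2)))"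
    by (simp add: moment_measure_sets)
  fix S assume "S \<in> sets (moment_measure (B x))"
  then have S[measurable]: "S \<in> sets borel" by (simp add: moment_measure_sets)
  define \<phi> where "\<phi> t = indicator S t * (t * indicator {0..m} t)" for t :: real
  have \<phi>: "\<phi> \<in> bounded_borel"
    unfolding \<phi>_def using S by (intro bounded_borel_mult identity_bounded_borel) simp
  have "emeasure (density (moment_measure x) (\<lambda>t. ennreal (t\<^sup>2))) S =
      (\<integral>\<^sup>+t. ennreal (t\<^sup>2) * indicator S t \<partial>moment_measure x)"
    by (subst emeasure_density) auto
  also have "\<dots> = (\<integral>\<^sup>+t. ennreal ((\<phi> t)\<^sup>2) \<partial>moment_measure x)"
    by (rule nn_integral_cong_AE, rule eventually_mono[OF moment_measure_carrier])
      (auto simp: \<phi>_def indicator_def)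
  also have "\<dots> = ennreal (\<integral>t. (\<phi> t)\<^sup>2 \<partial>moment_measure x)"
    using \<phi> bounded_borel_mult[OF \<phi> \<phi>]
    by (intro nn_integral_eq_integral integrable_bounded_borel moment_measure)
      (simp_all add: power2_eq_square)
  also have "\<dots> = ennreal ((norm (calc \<phi> x))\<^sup>2)"
    by (simp add: norm_calc_squared \<phi>)
  also have "calc \<phi> x = calc (indicator S) (B x)"
    using S calc_mult[of "indicator S" "\<lambda>t. t * indicator {0..m} t" x]
    by (simp add: \<phi>_def[abs_def] identity_bounded_borel calc_identity)
  finally show "emeasure (moment_measure (B x)) S = emeasure (density (moment_measure x) (\<lambda>t. ennreal (t\<^sup>2))) S"
    using S by (simp add: emeasure_moment_measure)
qed

text \<open>The density cancels the inverse: \<open>t^2 * inverse t = t\<close>, also at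
  \<open>0\<close> because \<open>inverse 0 = 0\<close>.\<close>

lemma integral_inverse_image: "(\<integral>t. inverse t \<partial>moment_measure (B z)) = B z \<bullet> z"
proof -
  note [measurable_cong] = moment_measure_sets
  have "(\<integral>t. inverse t \<partial>moment_measure (B z)) = (\<integral>t. t\<^sup>2 *\<^sub>R inverse t \<partial>moment_measure z)"
    unfolding moment_measure_image by (subst integral_density) auto
  also have "\<dots> = (\<integral>t. t ^ 1 * indicator {0..m} t \<partial>moment_measure z)"
    by (rule integral_cong_AE, measurable, rule eventually_mono[OF moment_measure_carrier])
      (auto simp: power2_eq_square field_simps)
  finally show ?thesis by (simp only: moment_measure_moment) simp
qed

lemma integrable_inverse_image: "integrable (moment_measure (B z)) (\<lambda>t. (inverse t)\<^sup>2)"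
proof -
  note [measurable_cong] = moment_measure_sets
  have "integrable (moment_measure z) (\<lambda>t. t\<^sup>2 *\<^sub>R (inverse t)\<^sup>2)"
  proof (intro integrable_bounded_borel moment_measure bounded_borelI)
    show "\<bar>t\<^sup>2 *\<^sub>R (inverse t)\<^sup>2\<bar> \<le> 1" for t :: real
      by (cases "t = 0") (auto simp: power2_eq_square field_simps)
  qed measurable
  then show ?thesis
    unfolding moment_measure_image by (subst integrable_density) auto
qed

text \<open>\<open>t\<close> times the indicator of \<open>{0}\<close> is zero, so this vector lies
  in the kernel of \<open>B\<close>.\<close>

lemma calc_indicator_0: "calc (indicator {0}) x = 0"
proof -
  have "B (calc (indicator {0}) x) = calc (\<lambda>t. t * indicator {0..m} t * indicator {0} t) x"
    using calc_mult[of "\<lambda>t. t * indicator {0..m} t" "indicator {0}" x]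
    by (simp add: identity_bounded_borel calc_identity)
  also have "(\<lambda>t::real. t * indicator {0..m} t * indicator {0} t) = (\<lambda>_. 0)"
    by (auto simp: indicator_def)
  finally show ?thesis
    by (rule injective[OF trans]) (simp add: calc_zero)
qed

text \<open>The preimage is the limit of \<open>calc (g n) u\<close>, where \<open>g n\<close> is
  \<open>1 / t\<close> cut off at \<open>d n\<close>. Square integrability of \<open>1 / t\<close>
  makes these vectors Cauchy, and \<open>B\<close> maps them to spectral cut-offs of
  \<open>u\<close> that converge to \<open>u\<close>.\<close>

lemma range_if_integrable_inverse:
  assumes int: "integrable (moment_measure u) (\<lambda>t. (inverse t)\<^sup>2)"
  shows "\<exists>z. B z = u"
proof -
  note [measurable_cong] = moment_measure_sets
  define d where "d n = inverse (real (Suc n))" for n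
  have d0: "0 < d n" for n by (simp add: d_def)
  have d_mono: "d k \<le> d n" if "n \<le> k" for n k using that by (simp add: d_def)
  have d_lim: "\<exists>N. \<forall>n\<ge>N. d n < t" if "0 < t" for t
    using reals_Archimedean[OF that] d_mono unfolding d_def by (metis order_le_less_trans)
  define g where "g n t = inverse t * indicator {d n<..} t" for n t
  have g: "g n \<in> bounded_borel" for n
  proof (rule bounded_borelI)
    show "g n \<in> borel_measurable borel" unfolding g_def by measurable
    show "\<bar>g n t\<bar> \<le> inverse (d n)" for t
      using d0[of n] by (auto simp: g_def indicator_def intro: le_imp_inverse_le)
  qed
  define z where "z n = calc (g n) u" for n
  define I where "I n = (\<integral>t. (g n t)\<^sup>2 \<partial>moment_measure u)" for n
  have g2: "integrable (moment_measure u) (\<lambda>t. (g n t)\<^sup>2)" for n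
    using bounded_borel_mult[OF g g]
    by (intro integrable_bounded_borel moment_measure) (simp add: power2_eq_square)
  have diff: "(norm (z k - z n))\<^sup>2 = I k - I n" if "n \<le> k" for n k
  proof -
    have "(norm (z k - z n))\<^sup>2 = (\<integral>t. (g k t - g n t)\<^sup>2 \<partial>moment_measure u)"
      by (simp add: z_def calc_diff[symmetric] norm_calc_squared g)
    \<comment> \<open>\<open>g n\<close> is \<open>g k\<close> cut at the larger threshold
      \<open>d n\<close>, so the product \<open>g k * g n\<close> is the square of
      \<open>g n\<close>.\<close>
    also have "(\<lambda>t. (g k t - g n t)\<^sup>2) = (\<lambda>t. (g k t)\<^sup>2 - (g n t)\<^sup>2)"
      using d_mono[OF that] by (auto simp: g_def indicator_def)
    finally show ?thesis
      by (simp add: I_def g2)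
  qed
  have "I \<longlonglongrightarrow> (\<integral>t. (inverse t * indicator {0<..} t)\<^sup>2 \<partial>moment_measure u)"
    unfolding I_def
  proof (rule integral_dominated_convergence[OF _ _ int])
    show "AE t in moment_measure u. (\<lambda>n. (g n t)\<^sup>2) \<longlonglongrightarrow> (inverse t * indicator {0<..} t)\<^sup>2"
    proof (rule AE_I2, rule tendsto_eventually)
      fix t :: real
      show "eventually (\<lambda>n. (g n t)\<^sup>2 = (inverse t * indicator {0<..} t)\<^sup>2) sequentially"
      proof (cases "0 < t")
        case True
        with d_lim[OF True] show ?thesis
          by (auto simp: eventually_sequentially g_def indicator_def)
      next
        case False
        then have "\<not> d n < t" for n using d0[of n] by linarith
        with False show ?thesis by (simp add: g_def)
      qed
    qed
    show "AE t in moment_measure u. norm ((g n t)\<^sup>2) \<le> (inverse t)\<^sup>2" for n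
      by (rule AE_I2) (simp add: g_def indicator_def)
  qed (use g2 in auto)
  then have "Cauchy I"
    by (rule LIMSEQ_imp_Cauchy)
  have "Cauchy z"
  proof (rule metric_CauchyI)
    fix e :: real assume "0 < e"
    then obtain N where N: "\<And>i j. N \<le> i \<Longrightarrow> N \<le> j \<Longrightarrow> dist (I i) (I j) < e\<^sup>2"
      using metric_CauchyD[OF \<open>Cauchy I\<close>, of "e\<^sup>2"] by auto
    have "norm (z i - z j) < e" if "N \<le> i" "N \<le> j" "j \<le> i" for i j
    proof (rule power2_less_imp_less)
      show "(norm (z i - z j))\<^sup>2 < e\<^sup>2"
        using N[OF that(1,2)] diff[OF that(3)] by (simp add: dist_real_def)
    qed (use \<open>0 < e\<close> in simp)
    then show "\<exists>N. \<forall>i\<ge>N. \<forall>j\<ge>N. dist (z i) (z j) < e"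
      by (intro exI[of _ N]) (metis dist_norm dist_commute nat_le_linear)
  qed
  then obtain l where l: "z \<longlonglongrightarrow> l"
    using Cauchy_convergent convergent_def by blast
  have Bz: "B (z n) = calc (indicator {d n<..}) u" for n
  proof -
    have "B (z n) = calc (\<lambda>t. t * indicator {0..m} t * g n t) u"
      using calc_mult[of "\<lambda>t. t * indicator {0..m} t" "g n" u]
      by (simp add: identity_bounded_borel calc_identity z_def g)
    also have "\<dots> = calc (indicator {d n<..}) u"
    proof (rule calc_cong)
      show "t * indicator {0..m} t * g n t = indicator {d n<..} t" if "t \<in> {0..m}" for t
        using that d0[of n] by (auto simp: g_def indicator_def)
    qed (simp_all add: identity_bounded_borel g)
    finally show ?thesis .
  qed
  have "bounded_limit (\<lambda>n. indicator {d n<..}) (indicator {0<..})"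
    unfolding bounded_limit_def
  proof (intro conjI allI exI)
    fix n and t :: real
    show "\<bar>indicator {d n<..} t\<bar> \<le> (1::real)" by (simp add: indicator_def)
    show "(\<lambda>n. indicator {d n<..} t) \<longlonglongrightarrow> (indicator {0<..} t :: real)"
    proof (rule tendsto_eventually, cases "0 < t")
      case True
      with d_lim[OF True] show "eventually (\<lambda>n. indicator {d n<..} t = (indicator {0<..} t :: real)) sequentially"
        by (auto simp: eventually_sequentially indicator_def)
    next
      case False
      then have "\<not> d n < t" for n using d0[of n] by linarith
      with False show "eventually (\<lambda>n. indicator {d n<..} t = (indicator {0<..} t :: real)) sequentially"
        by simp
    qed
  qed auto
  then have "(\<lambda>n. B (z n)) \<longlonglongrightarrow> calc (indicator {0<..}) u"
    unfolding Bz by (rule calc_tendsto)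
  moreover have "(\<lambda>n. B (z n)) \<longlonglongrightarrow> B l"
    by (rule B.tendsto[OF l])
  ultimately have "B l = calc (indicator {0<..}) u"
    using LIMSEQ_unique by blast
  also have "\<dots> = calc (\<lambda>t. 1 - indicator {0} t) u"
    by (rule calc_cong) (auto simp: indicator_def[of "{0<..}"] split: split_indicator)
  also have "\<dots> = u"
    by (simp add: calc_diff calc_one calc_indicator_0)
  finally show ?thesis ..
qed

text \<open>The domains agree because \<open>1 / t\<close> is square integrable exactly for vectors
  in the range of \<open>B\<close>. A value \<open>k\<close> at \<open>B x\<close> has the same
  products as \<open>x\<close> with the range of \<open>B\<close>; by symmetry
  \<open>B (k - x) = 0\<close>, and injectivity gives \<open>k = x\<close>.\<close>

theorem inverse_eq_spectral_integral: "{(B x, x) | x. True} = spectral_integral proj (\<lambda>x. x)"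
proof -
  note [measurable_cong] = moment_measure_sets
  have dom: "integrable (scalar_measure proj u) (\<lambda>x. x\<^sup>2) \<longleftrightarrow> (\<exists>z. u = B z)" for u
    unfolding scalar_measure_proj
    by (subst integrable_distr_eq) (auto intro: integrable_inverse_image dest: range_if_integrable_inverse)
  have val: "(\<integral>x. x \<partial>scalar_measure proj (B z)) = B z \<bullet> z" for z
    unfolding scalar_measure_proj by (subst integral_distr) (auto simp: integral_inverse_image)
  have pol: "((\<integral>x. x \<partial>scalar_measure proj (B x + B z)) - (\<integral>x. x \<partial>scalar_measure proj (B x - B z))) / 4 = x \<bullet> B z"
    for x z
  proof -
    have "B z \<bullet> x = B x \<bullet> z" "x \<bullet> B z = B x \<bullet> z"
      by (metis symmetric inner_commute)+
    then show ?thesis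
      unfolding B.add[symmetric] B.diff[symmetric] val
      by (simp add: B.add B.diff inner_add_left inner_add_right inner_diff_left inner_diff_right)
  qed
  have "(h, k) \<in> spectral_integral proj (\<lambda>x. x) \<longleftrightarrow> h = B k" for h k
  proof
    assume hk: "(h, k) \<in> spectral_integral proj (\<lambda>x. x)"
    then obtain x where x: "h = B x"
      by (auto simp: spectral_integral_def dom)
    have "k \<bullet> B z = x \<bullet> B z" for z
    proof -
      have "\<forall>u. (\<exists>z. u = B z) \<longrightarrow> k \<bullet> u = ((\<integral>x. x \<partial>scalar_measure proj (B x + u)) -
          (\<integral>x. x \<partial>scalar_measure proj (B x - u))) / 4"
        using hk unfolding x spectral_integral_def mem_Collect_eq prod.case dom by (rule conjunct2)
      then show ?thesis using pol[of x z] by metis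
    qed
    then have "B (k - x) \<bullet> z = 0" for z
      by (simp add: symmetric inner_diff_left)
    then have "B (k - x) = 0"
      by (intro inner_eqI) simp
    then have "k - x = 0"
      by (rule injective)
    then show "h = B k" using x by simp
  next
    assume "h = B k"
    then show "(h, k) \<in> spectral_integral proj (\<lambda>x. x)"
      using dom pol by (auto simp: spectral_integral_def)
  qed
  then show ?thesis by auto
qed

end

section \<open>Quadratic forms of a spectral resolution\<close>

text \<open>Lifts an identity between masses of sets to integrals. With values in
  \<open>ennreal\<close> it also transfers finiteness, hence membership in the domains
  below.\<close>

lemma nn_integral_lincomb_eq:
  fixes M1 M2 M3 M4 :: "real measure" and f :: "real \<Rightarrow> ennreal"
  assumes sets: "sets M1 = sets borel" "sets M2 = sets borel" "sets M3 = sets borel" "sets M4 = sets borel"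
    and eq: "\<And>S. S \<in> sets borel \<Longrightarrow>
      emeasure M1 S + emeasure M2 S = a * emeasure M3 S + b * emeasure M4 S"
    and f: "f \<in> borel_measurable borel"
  shows "(\<integral>\<^sup>+x. f x \<partial>M1) + (\<integral>\<^sup>+x. f x \<partial>M2) = a * (\<integral>\<^sup>+x. f x \<partial>M3) + b * (\<integral>\<^sup>+x. f x \<partial>M4)"
  using f
proof (induction rule: borel_measurable_induct)
  case (cong f g)
  then have "f = g" by (auto simp: space_borel)
  with cong show ?case by simp
next
  case (set S)
  then show ?case using eq by (simp add: sets)
next
  note [measurable_cong] = sets
  case (mult u c)
  note [measurable] = mult.hyps(2)
  have "(\<integral>\<^sup>+x. c * u x \<partial>M1) + (\<integral>\<^sup>+x. c * u x \<partial>M2) = c * ((\<integral>\<^sup>+x. u x \<partial>M1) + (\<integral>\<^sup>+x. u x \<partial>M2))"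
    by (simp add: nn_integral_cmult distrib_left)
  also have "\<dots> = a * (\<integral>\<^sup>+x. c * u x \<partial>M3) + b * (\<integral>\<^sup>+x. c * u x \<partial>M4)"
    by (simp add: mult nn_integral_cmult distrib_left mult.left_commute)
  finally show ?case .
next
  note [measurable_cong] = sets
  case (add u v)
  note [measurable] = add.hyps(1,3)
  have "(\<integral>\<^sup>+x. v x + u x \<partial>M1) + (\<integral>\<^sup>+x. v x + u x \<partial>M2) =
      ((\<integral>\<^sup>+x. u x \<partial>M1) + (\<integral>\<^sup>+x. u x \<partial>M2)) + ((\<integral>\<^sup>+x. v x \<partial>M1) + (\<integral>\<^sup>+x. v x \<partial>M2))"
    by (simp add: nn_integral_add add_ac)
  also have "\<dots> = a * (\<integral>\<^sup>+x. v x + u x \<partial>M3) + b * (\<integral>\<^sup>+x. v x + u x \<partial>M4)"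
    unfolding add.IH by (simp add: nn_integral_add distrib_left add_ac)
  finally show ?case .
next
  note [measurable_cong] = sets
  case (seq U)
  note [measurable] = seq.hyps(1)
  have mono: "incseq (\<lambda>i. \<integral>\<^sup>+x. U i x \<partial>M)" for M :: "real measure"
    using \<open>incseq U\<close> by (auto simp: incseq_def le_fun_def intro!: nn_integral_mono)
  have sup: "(\<integral>\<^sup>+x. (SUP i. U i) x \<partial>M) = (SUP i. \<integral>\<^sup>+x. U i x \<partial>M)" if "sets M = sets borel" for M :: "real measure"
    using nn_integral_monotone_convergence_SUP[OF \<open>incseq U\<close>, of M] seq(1)
    by (simp add: image_comp measurable_cong_sets[OF that refl])
  have "(SUP i. \<integral>\<^sup>+x. U i x \<partial>M1) + (SUP i. \<integral>\<^sup>+x. U i x \<partial>M2) =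
      (SUP i. (\<integral>\<^sup>+x. U i x \<partial>M1) + (\<integral>\<^sup>+x. U i x \<partial>M2))"
    by (rule ennreal_SUP_add[symmetric]) (rule mono)+
  also have "\<dots> = (SUP i. a * (\<integral>\<^sup>+x. U i x \<partial>M3) + b * (\<integral>\<^sup>+x. U i x \<partial>M4))"
    by (simp add: seq)
  also have "\<dots> = (SUP i. a * (\<integral>\<^sup>+x. U i x \<partial>M3)) + (SUP i. b * (\<integral>\<^sup>+x. U i x \<partial>M4))"
    by (rule ennreal_SUP_add) (use mono in \<open>auto simp: incseq_def intro!: mult_left_mono\<close>)
  finally show ?case
    by (simp only: sup sets SUP_mult_left_ennreal)
qed

text \<open>For positive \<open>x\<close> and \<open>y\<close> the right-hand side is least at
  \<open>t = sqrt y / sqrt x\<close>, with value \<open>(sqrt x + sqrt y)^2\<close>.\<close>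

lemma sqrt_triangle:
  fixes x y z :: real
  assumes "0 \<le> x" "0 \<le> y"
    and le: "\<And>t. 0 < t \<Longrightarrow> z \<le> (1 + t) * x + (1 + 1 / t) * y"
  shows "sqrt z \<le> sqrt x + sqrt y"
proof (rule field_le_epsilon)
  fix e :: real assume e: "0 < e"
  \<comment> \<open>The shift by \<open>e / 2\<close> keeps the near-optimal parameter
    \<open>b / a\<close> positive and well defined when \<open>x\<close> or \<open>y\<close> is
    zero.\<close>
  define a where "a = sqrt x + e / 2"
  define b where "b = sqrt y + e / 2"
  have ab: "0 < a" "0 < b"
    using assms e by (auto simp: a_def b_def add_nonneg_pos)
  have "x \<le> a\<^sup>2" "y \<le> b\<^sup>2"
    using power_mono[of "sqrt x" a 2] power_mono[of "sqrt y" b 2] assms e by (auto simp: a_def b_def)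
  have "z \<le> (1 + b / a) * x + (1 + 1 / (b / a)) * y"
    using ab by (intro le) simp
  also have "\<dots> \<le> (1 + b / a) * a\<^sup>2 + (1 + 1 / (b / a)) * b\<^sup>2"
    using ab \<open>x \<le> a\<^sup>2\<close> \<open>y \<le> b\<^sup>2\<close> by (intro add_mono mult_left_mono) auto
  also have "\<dots> = (a + b)\<^sup>2"
    using ab by (simp add: field_simps power2_eq_square)
  finally have "sqrt z \<le> a + b"
    using ab by (simp add: real_le_lsqrt)
  then show "sqrt z \<le> sqrt x + sqrt y + e"
    by (simp add: a_def b_def)
qed

section \<open>Parallelogram identities for scalar measures\<close>

context spectral_projections
begin

lemma proj_simps:
  assumes "S \<in> sets borel"
  shows "E S (x + y) = E S x + E S y" "E S (x - y) = E S x - E S y" "E S (c *\<^sub>R x) = c *\<^sub>R E S x"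
    "E S 0 = 0"
proof -
  interpret bounded_linear "E S" by (rule bounded_linear[OF assms])
  show "E S (x + y) = E S x + E S y" "E S (x - y) = E S x - E S y" "E S (c *\<^sub>R x) = c *\<^sub>R E S x"
    "E S 0 = 0"
    by (simp_all add: add diff scaleR)
qed

lemma scalar_measure_scale: "scalar_measure E (c *\<^sub>R x) = density (scalar_measure E x) (\<lambda>_. ennreal (c\<^sup>2))"
  by (rule measure_eqI)
    (auto simp: emeasure_scalar_measure proj_simps emeasure_density nn_integral_cmult_indicator
      power_mult_distrib ennreal_mult)

lemma integral_scale:
  fixes \<phi> :: "real \<Rightarrow> real"
  assumes [measurable]: "\<phi> \<in> borel_measurable borel"
  shows "(\<integral>t. \<phi> t \<partial>scalar_measure E (c *\<^sub>R x)) = c\<^sup>2 * (\<integral>t. \<phi> t \<partial>scalar_measure E x)"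
  by (simp add: scalar_measure_scale integral_density)

lemma scalar_measure_minus: "scalar_measure E (x - y) = scalar_measure E (y - x)"
proof -
  have "scalar_measure E (x - y) = scalar_measure E ((-1) *\<^sub>R (y - x))"
    by simp
  also have "\<dots> = scalar_measure E (y - x)"
    unfolding scalar_measure_scale by (simp add: density_1)
  finally show ?thesis .
qed

text \<open>With \<open>r = sqrt t\<close> the mixed terms of
  \<open>|u + v|^2 + |r u - v / r|^2\<close> cancel. Dropping the second integral gives the
  hypothesis of \<open>sqrt_triangle\<close>, that is, a Minkowski inequality for the form.\<close>

lemma nn_integral_weighted_parallelogram:
  fixes f :: "real \<Rightarrow> ennreal"
  assumes t: "0 < t" and f: "f \<in> borel_measurable borel"
  shows "(\<integral>\<^sup>+s. f s \<partial>scalar_measure E (x + y)) + (\<integral>\<^sup>+s. f s \<partial>scalar_measure E (sqrt t *\<^sub>R x - (1 / sqrt t) *\<^sub>R y)) =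
    ennreal (1 + t) * (\<integral>\<^sup>+s. f s \<partial>scalar_measure E x) + ennreal (1 + 1 / t) * (\<integral>\<^sup>+s. f s \<partial>scalar_measure E y)"
proof (rule nn_integral_lincomb_eq)
  fix S :: "real set" assume S: "S \<in> sets borel"
  have *: "(norm (u + v))\<^sup>2 + (norm (sqrt t *\<^sub>R u - (1 / sqrt t) *\<^sub>R v))\<^sup>2 =
      (1 + t) * (norm u)\<^sup>2 + (1 + 1 / t) * (norm v)\<^sup>2" for u v :: 'a
  proof -
    define r where "r = sqrt t"
    have r: "t = r * r" "r \<noteq> 0" using t by (simp_all add: r_def)
    show ?thesis
      unfolding power2_norm_eq_inner r_def[symmetric] r(1) using r(2)
      by (simp add: inner_add_left inner_add_right inner_diff_left inner_diff_right inner_commute[of v u]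
          field_simps)
  qed
  show "emeasure (scalar_measure E (x + y)) S + emeasure (scalar_measure E (sqrt t *\<^sub>R x - (1 / sqrt t) *\<^sub>R y)) S =
      ennreal (1 + t) * emeasure (scalar_measure E x) S + ennreal (1 + 1 / t) * emeasure (scalar_measure E y) S"
    using t *[of "E S x" "E S y"]
    by (simp add: emeasure_scalar_measure S proj_simps del: ennreal_plus flip: ennreal_plus ennreal_mult)
qed (simp_all add: f)

lemma nn_integral_parallelogram:
  fixes f :: "real \<Rightarrow> ennreal"
  assumes f: "f \<in> borel_measurable borel"
  shows "(\<integral>\<^sup>+s. f s \<partial>scalar_measure E (x + y)) + (\<integral>\<^sup>+s. f s \<partial>scalar_measure E (x - y)) =
    2 * (\<integral>\<^sup>+s. f s \<partial>scalar_measure E x) + 2 * (\<integral>\<^sup>+s. f s \<partial>scalar_measure E y)"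
  using nn_integral_weighted_parallelogram[OF zero_less_one f, of x y] by simp

section \<open>Domains of spectral integrals and localisation by projections\<close>

definition square_domain :: "(real \<Rightarrow> real) \<Rightarrow> 'a set" where
  "square_domain \<phi> = {h. integrable (scalar_measure E h) (\<lambda>x. (\<phi> x)\<^sup>2)}"

lemma square_domain_iff:
  assumes [measurable]: "\<phi> \<in> borel_measurable borel"
  shows "h \<in> square_domain \<phi> \<longleftrightarrow> (\<integral>\<^sup>+s. ennreal ((\<phi> s)\<^sup>2) \<partial>scalar_measure E h) < \<infinity>"
  by (simp add: square_domain_def integrable_iff_bounded)

lemma
  assumes \<phi>: "\<phi> \<in> borel_measurable borel" and x: "x \<in> square_domain \<phi>" and y: "y \<in> square_domain \<phi>"
  shows square_domain_add: "x + y \<in> square_domain \<phi>"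
    and square_domain_diff: "x - y \<in> square_domain \<phi>"
proof -
  note [measurable] = \<phi>
  let ?f = "\<lambda>s. ennreal ((\<phi> s)\<^sup>2)"
  have meas: "?f \<in> borel_measurable borel" by measurable
  have "(\<integral>\<^sup>+s. ?f s \<partial>scalar_measure E (x + y)) + (\<integral>\<^sup>+s. ?f s \<partial>scalar_measure E (x - y)) < \<infinity>"
    unfolding nn_integral_parallelogram[OF meas] using x y by (auto simp: square_domain_iff[OF \<phi>] ennreal_mult_less_top)
  then show "x + y \<in> square_domain \<phi>" "x - y \<in> square_domain \<phi>"
    by (simp_all add: square_domain_iff[OF \<phi>])
qed

lemma square_domain_integrable:
  assumes [measurable]: "\<phi> \<in> borel_measurable borel" and "x \<in> square_domain \<phi>"
  shows "integrable (scalar_measure E x) \<phi>"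
proof -
  interpret finite_measure "scalar_measure E x" by (rule finite_scalar_measure)
  show ?thesis
    by (rule square_integrable_imp_integrable) (use assms(2) in \<open>auto simp: square_domain_def\<close>)
qed

text \<open>Vectors with the same projection onto \<open>S\<close> give every Borel subset of
  \<open>S\<close> the same mass, since \<open>E (S \<inter> R)\<close> factors through
  \<open>E S\<close>.\<close>

lemma
  assumes [measurable]: "S \<in> sets borel" and eq: "E S a = E S b"
    and \<phi>[measurable]: "\<phi> \<in> borel_measurable borel"
  shows integral_localised: "(\<integral>t. indicator S t * \<phi> t \<partial>scalar_measure E a) = (\<integral>t. indicator S t * (\<phi> t::real) \<partial>scalar_measure E b)"
    and integrable_localised: "integrable (scalar_measure E a) (\<lambda>t. indicator S t * \<phi> t) \<longleftrightarrow>
      integrable (scalar_measure E b) (\<lambda>t. indicator S t * \<phi> t)"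
proof -
  have "density (scalar_measure E a) (\<lambda>t. ennreal (indicator S t)) = density (scalar_measure E b) (\<lambda>t. ennreal (indicator S t))"
  proof (rule measure_eqI)
    fix R assume "R \<in> sets (density (scalar_measure E a) (\<lambda>t. ennreal (indicator S t)))"
    then have R: "R \<in> sets borel" by simp
    have "E (S \<inter> R) a = E (S \<inter> R) b"
      using eq Int[OF R assms(1)] by (metis inf_commute)
    moreover have "emeasure (density (scalar_measure E h) (\<lambda>t. ennreal (indicator S t))) R =
        emeasure (scalar_measure E h) (S \<inter> R)" for h
      using R by (simp add: emeasure_density ennreal_indicator indicator_inter_arith[symmetric] nn_integral_indicator)
    ultimately show "emeasure (density (scalar_measure E a) (\<lambda>t. ennreal (indicator S t))) R =
        emeasure (density (scalar_measure E b) (\<lambda>t. ennreal (indicator S t))) R"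
      using R by (simp add: emeasure_scalar_measure)
  qed simp
  moreover have "integral\<^sup>L (density (scalar_measure E h) (\<lambda>t. ennreal (indicator S t))) \<phi> =
      (\<integral>t. indicator S t * \<phi> t \<partial>scalar_measure E h)" for h
    by (subst integral_density) auto
  moreover have "integrable (density (scalar_measure E h) (\<lambda>t. ennreal (indicator S t))) \<phi> \<longleftrightarrow>
      integrable (scalar_measure E h) (\<lambda>t. indicator S t * \<phi> t)" for h
    by (subst integrable_density) auto
  ultimately show "(\<integral>t. indicator S t * \<phi> t \<partial>scalar_measure E a) = (\<integral>t. indicator S t * \<phi> t \<partial>scalar_measure E b)"
    "integrable (scalar_measure E a) (\<lambda>t. indicator S t * \<phi> t) \<longleftrightarrow>
      integrable (scalar_measure E b) (\<lambda>t. indicator S t * \<phi> t)"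
    by metis+
qed

lemma E_compl: "S \<in> sets borel \<Longrightarrow> E (- S) (E S x) = 0" "S \<in> sets borel \<Longrightarrow> E S (E S x) = E S x"
  by (simp_all add: Int)

lemma integrable_zero_vector:
  fixes \<phi> :: "real \<Rightarrow> real"
  assumes [measurable]: "\<phi> \<in> borel_measurable borel"
  shows "integrable (scalar_measure E 0) \<phi>"
proof -
  have "scalar_measure E 0 = null_measure borel"
    by (rule measure_eqI) (simp_all add: emeasure_scalar_measure proj_simps)
  then show ?thesis by simp
qed

lemma integrable_projection:
  fixes \<phi> :: "real \<Rightarrow> real"
  assumes S[measurable]: "S \<in> sets borel" and \<phi>[measurable]: "\<phi> \<in> borel_measurable borel"
    and int: "integrable (scalar_measure E u) (\<lambda>t. indicator S t * \<phi> t)"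
  shows "integrable (scalar_measure E (E S u)) \<phi>"
proof -
  have "integrable (scalar_measure E (E S u)) (\<lambda>t. indicator S t * \<phi> t)"
    using integrable_localised[OF S, of "E S u" u \<phi>] int by (simp add: E_compl)
  moreover have "integrable (scalar_measure E (E S u)) (\<lambda>t. indicator (- S) t * \<phi> t)"
    using integrable_localised[of "- S" "E S u" 0 \<phi>] by (simp add: E_compl proj_simps integrable_zero_vector)
  ultimately have "integrable (scalar_measure E (E S u)) (\<lambda>t. indicator S t * \<phi> t + indicator (- S) t * \<phi> t)"
    by (rule Bochner_Integration.integrable_add)
  also have "(\<lambda>t. indicator S t * \<phi> t + indicator (- S) t * \<phi> t) = \<phi>"
    by (auto simp: indicator_def)
  finally show ?thesis .
qed

lemma square_domain_projection:
  assumes S[measurable]: "S \<in> sets borel" and [measurable]: "\<phi> \<in> borel_measurable borel" and u: "u \<in> square_domain \<phi>"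
  shows "E S u \<in> square_domain \<phi>"
  using u integrable_real_mult_indicator[of S "scalar_measure E u" "\<lambda>t. (\<phi> t)\<^sup>2"] unfolding square_domain_def
  by (auto intro!: integrable_projection simp: mult.commute)

text \<open>The source of test vectors: projecting onto a set where \<open>\<phi>\<close> is bounded
  brings any vector into the domain.\<close>

lemma square_domain_bounded_projection:
  assumes S: "S \<in> sets borel" and [measurable]: "\<phi> \<in> borel_measurable borel"
    and bb: "(\<lambda>t. indicator S t * \<phi> t) \<in> bounded_borel"
  shows "E S u \<in> square_domain \<phi>"
proof -
  have "(\<lambda>t. indicator S t * (\<phi> t)\<^sup>2) = (\<lambda>t. (indicator S t * \<phi> t) * (indicator S t * \<phi> t))"
    by (auto simp: indicator_def power2_eq_square)
  then have "(\<lambda>t. indicator S t * (\<phi> t)\<^sup>2) \<in> bounded_borel"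
    using bounded_borel_mult[OF bb bb] by simp
  then have "integrable (scalar_measure E u) (\<lambda>t. indicator S t * (\<phi> t)\<^sup>2)"
    by (intro integrable_bounded_borel finite_scalar_measure) simp_all
  then show ?thesis
    using S by (auto simp: square_domain_def intro!: integrable_projection)
qed

text \<open>Moves a projection from the vector into the integrand. Off \<open>S\<close> both
  \<open>v + E S y\<close> and \<open>v - E S y\<close> look like \<open>v\<close> and cancel; on
  \<open>S\<close> they look like \<open>v + y\<close> and \<open>v - y\<close>.\<close>

lemma integral_polar_projection:
  assumes S[measurable]: "S \<in> sets borel" and \<phi>[measurable]: "\<phi> \<in> borel_measurable borel"
    and v: "v \<in> square_domain \<phi>" and u: "E S y \<in> square_domain \<phi>"
  shows "(\<integral>t. \<phi> t \<partial>scalar_measure E (v + E S y)) - (\<integral>t. \<phi> t \<partial>scalar_measure E (v - E S y)) =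
    (\<integral>t. indicator S t * \<phi> t \<partial>scalar_measure E (v + y)) - (\<integral>t. indicator S t * \<phi> t \<partial>scalar_measure E (v - y))"
proof -
  have split: "(\<integral>t. \<phi> t \<partial>scalar_measure E h) =
      (\<integral>t. indicator S t * \<phi> t \<partial>scalar_measure E h) + (\<integral>t. indicator (- S) t * \<phi> t \<partial>scalar_measure E h)"
    if "h \<in> square_domain \<phi>" for h
  proof -
    have int: "integrable (scalar_measure E h) \<phi>"
      using that by (intro square_domain_integrable \<phi>)
    have "\<phi> = (\<lambda>t. indicator S t * \<phi> t + indicator (- S) t * \<phi> t)"
      by (auto simp: indicator_def)
    then have "(\<integral>t. \<phi> t \<partial>scalar_measure E h) = (\<integral>t. indicator S t * \<phi> t + indicator (- S) t * \<phi> t \<partial>scalar_measure E h)"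
      by simp
    also have "\<dots> = (\<integral>t. indicator S t * \<phi> t \<partial>scalar_measure E h) + (\<integral>t. indicator (- S) t * \<phi> t \<partial>scalar_measure E h)"
      using integrable_real_mult_indicator[OF _ int, of S] integrable_real_mult_indicator[OF _ int, of "- S"]
      by (intro Bochner_Integration.integral_add) (simp_all add: mult.commute)
    finally show ?thesis .
  qed
  have "(\<integral>t. indicator (- S) t * \<phi> t \<partial>scalar_measure E (v + E S y)) = (\<integral>t. indicator (- S) t * \<phi> t \<partial>scalar_measure E v)"
    "(\<integral>t. indicator (- S) t * \<phi> t \<partial>scalar_measure E (v - E S y)) = (\<integral>t. indicator (- S) t * \<phi> t \<partial>scalar_measure E v)"
    by (intro integral_localised; simp add: proj_simps E_compl)+
  moreover have "(\<integral>t. indicator S t * \<phi> t \<partial>scalar_measure E (v + E S y)) = (\<integral>t. indicator S t * \<phi> t \<partial>scalar_measure E (v + y))"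
    "(\<integral>t. indicator S t * \<phi> t \<partial>scalar_measure E (v - E S y)) = (\<integral>t. indicator S t * \<phi> t \<partial>scalar_measure E (v - y))"
    by (intro integral_localised; simp add: proj_simps E_compl)+
  moreover have "v + E S y \<in> square_domain \<phi>" "v - E S y \<in> square_domain \<phi>"
    by (intro square_domain_add square_domain_diff \<phi> v u)+
  ultimately show ?thesis by (simp add: split)
qed

section \<open>Algebra of spectral integrals and their quadratic forms\<close>

lemma spectral_integral_iff:
  "(h, k) \<in> spectral_integral E \<phi> \<longleftrightarrow> h \<in> square_domain \<phi> \<and>
    (\<forall>u\<in>square_domain \<phi>. k \<bullet> u = ((\<integral>x. \<phi> x \<partial>scalar_measure E (h + u)) -
       (\<integral>x. \<phi> x \<partial>scalar_measure E (h - u))) / 4)"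
  by (auto simp: spectral_integral_def square_domain_def)

lemma spectral_integral_inner_self:
  assumes \<phi>: "\<phi> \<in> borel_measurable borel" and hk: "(h, k) \<in> spectral_integral E \<phi>"
  shows "k \<bullet> h = (\<integral>x. \<phi> x \<partial>scalar_measure E h)"
proof -
  have "k \<bullet> h = ((\<integral>x. \<phi> x \<partial>scalar_measure E (h + h)) - (\<integral>x. \<phi> x \<partial>scalar_measure E (h - h))) / 4"
    using hk unfolding spectral_integral_iff by blast
  moreover have "h + h = 2 *\<^sub>R h" "h - h = 0 *\<^sub>R h"
    by (simp_all add: scaleR_2)
  ultimately show ?thesis
    by (simp only: integral_scale[OF \<phi>]) simp
qed

text \<open>Spectral projections commute with the operator: the projection passes from
  \<open>u\<close> into the integrand and, the polarised form being symmetric, from there onto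
  \<open>h\<close>.\<close>

lemma spectral_integral_projection:
  assumes S: "S \<in> sets borel" and \<phi>: "\<phi> \<in> borel_measurable borel"
    and hk: "(h, k) \<in> spectral_integral E \<phi>"
  shows "(E S h, E S k) \<in> spectral_integral E \<phi>"
  unfolding spectral_integral_iff
proof (intro conjI ballI)
  have h: "h \<in> square_domain \<phi>" using hk by (simp add: spectral_integral_iff)
  then show Sh: "E S h \<in> square_domain \<phi>" by (intro square_domain_projection S \<phi>)
  fix u assume u: "u \<in> square_domain \<phi>"
  then have Su: "E S u \<in> square_domain \<phi>" by (intro square_domain_projection S \<phi>)
  have "E S k \<bullet> u = k \<bullet> E S u" by (rule symmetric[OF S])
  also have "\<dots> = ((\<integral>x. \<phi> x \<partial>scalar_measure E (h + E S u)) - (\<integral>x. \<phi> x \<partial>scalar_measure E (h - E S u))) / 4"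
    using hk Su unfolding spectral_integral_iff by blast
  also have "\<dots> = ((\<integral>t. indicator S t * \<phi> t \<partial>scalar_measure E (u + h)) - (\<integral>t. indicator S t * \<phi> t \<partial>scalar_measure E (u - h))) / 4"
    unfolding integral_polar_projection[OF S \<phi> h Su] by (simp only: add.commute scalar_measure_minus[of u h])
  also have "\<dots> = ((\<integral>x. \<phi> x \<partial>scalar_measure E (E S h + u)) - (\<integral>x. \<phi> x \<partial>scalar_measure E (E S h - u))) / 4"
    unfolding integral_polar_projection[OF S \<phi> u Sh, symmetric]
    by (simp only: add.commute scalar_measure_minus[of u "E S h"])
  finally show "E S k \<bullet> u = ((\<integral>x. \<phi> x \<partial>scalar_measure E (E S h + u)) - (\<integral>x. \<phi> x \<partial>scalar_measure E (E S h - u))) / 4" .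
qed

text \<open>Additivity of the polarised form, by the Jordan--von Neumann argument.\<close>

lemma spectral_integral_diff:
  assumes \<phi>: "\<phi> \<in> borel_measurable borel" and nonneg: "\<And>t. 0 \<le> \<phi> t"
    and hk: "(h, k) \<in> spectral_integral E \<phi>" and hk': "(h', k') \<in> spectral_integral E \<phi>"
  shows "(h - h', k - k') \<in> spectral_integral E \<phi>"
  unfolding spectral_integral_iff
proof (intro conjI ballI)
  note dom_add = square_domain_add[OF \<phi>] and dom_diff = square_domain_diff[OF \<phi>]
  have h: "h \<in> square_domain \<phi>" "h' \<in> square_domain \<phi>"
    using hk hk' by (simp_all add: spectral_integral_iff)
  then show "h - h' \<in> square_domain \<phi>" by (rule dom_diff)
  define Q where "Q x = (\<integral>t. \<phi> t \<partial>scalar_measure E x)" for x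
  have Q_par: "Q (x + y) + Q (x - y) = 2 * Q x + 2 * Q y"
    if x: "x \<in> square_domain \<phi>" and y: "y \<in> square_domain \<phi>" for x y
  proof -
    have Q_nn: "(\<integral>\<^sup>+s. ennreal (\<phi> s) \<partial>scalar_measure E z) = ennreal (Q z)" if "z \<in> square_domain \<phi>" for z
      unfolding Q_def by (intro nn_integral_eq_integral square_domain_integrable \<phi> that) (simp add: nonneg)
    have Q0: "0 \<le> Q z" for z
      unfolding Q_def by (simp add: nonneg)
    have "ennreal (Q (x + y) + Q (x - y)) = ennreal (2 * Q x + 2 * Q y)"
      using nn_integral_parallelogram[of "\<lambda>s. ennreal (\<phi> s)" x y] \<phi>
      by (simp add: Q_nn Q0 x y dom_add dom_diff ennreal_mult)
    then show ?thesis
      using Q0 by (simp del: ennreal_plus)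
  qed
  have Q_minus: "Q (x - y) = Q (y - x)" for x y
    unfolding Q_def by (simp only: scalar_measure_minus)
  fix u assume u: "u \<in> square_domain \<phi>"
  \<comment> \<open>Take the first minus the second and the third minus the fourth: the terms
    containing \<open>h + h'\<close> cancel between these two differences.\<close>
  have "Q (h + u + h') + Q (h + u - h') = 2 * Q (h + u) + 2 * Q h'"
    "Q (h - u + h') + Q (h - u - h') = 2 * Q (h - u) + 2 * Q h'"
    "Q (h' + u + h) + Q (h' + u - h) = 2 * Q (h' + u) + 2 * Q h"
    "Q (h' - u + h) + Q (h' - u - h) = 2 * Q (h' - u) + 2 * Q h"
    by (intro Q_par dom_add dom_diff h u)+
  moreover have "Q (h' + u + h) = Q (h + u + h')" "Q (h' - u + h) = Q (h - u + h')"
    "Q (h - h' + u) = Q (h + u - h')" "Q (h - h' - u) = Q (h - u - h')"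
    by (simp_all add: algebra_simps)
  moreover have "Q (h' + u - h) = Q (h - u - h')" "Q (h' - u - h) = Q (h + u - h')"
    using Q_minus[of "h' + u" h] Q_minus[of "h' - u" h] by (simp_all add: algebra_simps)
  ultimately have "Q (h - h' + u) - Q (h - h' - u) = (Q (h + u) - Q (h - u)) - (Q (h' + u) - Q (h' - u))"
    by argo
  moreover have "k \<bullet> u = (Q (h + u) - Q (h - u)) / 4" "k' \<bullet> u = (Q (h' + u) - Q (h' - u)) / 4"
    using hk hk' u unfolding spectral_integral_iff Q_def by blast+
  ultimately show "(k - k') \<bullet> u = ((\<integral>x. \<phi> x \<partial>scalar_measure E (h - h' + u)) - (\<integral>x. \<phi> x \<partial>scalar_measure E (h - h' - u))) / 4"
    by (simp add: Q_def inner_diff_left diff_divide_distrib)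
qed

lemma Domain_spectral_integral_diff:
  assumes "\<phi> \<in> borel_measurable borel" "\<And>t. 0 \<le> \<phi> t"
    and "h \<in> Domain (spectral_integral E \<phi>)" "h' \<in> Domain (spectral_integral E \<phi>)"
  shows "h - h' \<in> Domain (spectral_integral E \<phi>)"
  using assms spectral_integral_diff by (metis Domain.cases Domain.intros)

text \<open>Every \<open>k\<close> that the choice in \<open>quadratic_form\<close> may pick gives
  the same product with \<open>h\<close>.\<close>

lemma quadratic_form_spectral_integral:
  assumes \<phi>: "\<phi> \<in> borel_measurable borel" and h: "h \<in> Domain (spectral_integral E \<phi>)"
  shows "quadratic_form (spectral_integral E \<phi>) h = (\<integral>t. \<phi> t \<partial>scalar_measure E h)"
proof -
  have "(h, SOME k. (h, k) \<in> spectral_integral E \<phi>) \<in> spectral_integral E \<phi>"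
    using h by (auto intro: someI)
  then show ?thesis
    unfolding quadratic_form_def by (subst inner_commute) (rule spectral_integral_inner_self[OF \<phi>])
qed

lemma sqrt_integral_triangle:
  assumes \<phi>: "\<phi> \<in> borel_measurable borel" and nonneg: "\<And>t. 0 \<le> \<phi> t"
    and x: "x \<in> square_domain \<phi>" and y: "y \<in> square_domain \<phi>"
  shows "sqrt (\<integral>t. \<phi> t \<partial>scalar_measure E (x + y)) \<le>
    sqrt (\<integral>t. \<phi> t \<partial>scalar_measure E x) + sqrt (\<integral>t. \<phi> t \<partial>scalar_measure E y)"
proof (rule sqrt_triangle)
  define Q where "Q x = (\<integral>t. \<phi> t \<partial>scalar_measure E x)" for x
  have Q_nn: "(\<integral>\<^sup>+s. ennreal (\<phi> s) \<partial>scalar_measure E z) = ennreal (Q z)" if "z \<in> square_domain \<phi>" for z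
    unfolding Q_def by (intro nn_integral_eq_integral square_domain_integrable \<phi> that) (simp add: nonneg)
  have Q0: "0 \<le> Q z" for z
    unfolding Q_def by (simp add: nonneg)
  fix t :: real assume t: "0 < t"
  have "ennreal (Q (x + y)) \<le> ennreal (1 + t) * ennreal (Q x) + ennreal (1 + 1 / t) * ennreal (Q y)"
    using nn_integral_weighted_parallelogram[OF t, of "\<lambda>s. ennreal (\<phi> s)" x y] \<phi>
    by (simp add: Q_nn x y square_domain_add[OF \<phi>]) (metis add_increasing2 le_iff_add order_refl zero_le)
  also have "\<dots> = ennreal ((1 + t) * Q x + (1 + 1 / t) * Q y)"
    using t Q0 by (simp add: ennreal_plus[symmetric] ennreal_mult[symmetric] del: ennreal_plus)
  finally show "(\<integral>t. \<phi> t \<partial>scalar_measure E (x + y)) \<le>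
      (1 + t) * (\<integral>t. \<phi> t \<partial>scalar_measure E x) + (1 + 1 / t) * (\<integral>t. \<phi> t \<partial>scalar_measure E y)"
    unfolding Q_def[symmetric] using t Q0 by (subst (asm) ennreal_le_iff) auto
qed (simp_all add: nonneg)

end

section \<open>The spectral measure of the inverse of a bounded operator\<close>

text \<open>What is known of the resolution picked by \<open>spectral_measure\<close>: its graph,
  not its construction. \<open>norm_bound\<close> is the operator inequality
  \<open>B^2 \<le> N B\<close>.\<close>

locale inverse_resolution = spectral_projections E
  for E :: "real set \<Rightarrow> 'a::real_inner \<Rightarrow> 'a" +
  fixes B :: "'a \<Rightarrow> 'a" and N :: real
  assumes graph: "{(B x, x) | x. True} = spectral_integral E (\<lambda>x. x)"
    and N_pos: "0 < N"
    and norm_bound: "(norm (B x))\<^sup>2 \<le> N * (B x \<bullet> x)"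
    and injective: "B x = 0 \<Longrightarrow> x = 0"
begin

lemma graph_iff: "(h, k) \<in> spectral_integral E (\<lambda>x. x) \<longleftrightarrow> h = B k"
  using graph by blast

lemma range_square_domain: "B y \<in> square_domain (\<lambda>x. x)"
  using graph_iff[of "B y" y] by (simp add: spectral_integral_iff)

lemma inner_square_domain:
  "u \<in> square_domain (\<lambda>x. x) \<Longrightarrow>
    y \<bullet> u = ((\<integral>x. x \<partial>scalar_measure E (B y + u)) - (\<integral>x. x \<partial>scalar_measure E (B y - u))) / 4"
  using graph_iff[of "B y" y] by (simp add: spectral_integral_iff)

lemma projection_commute: "S \<in> sets borel \<Longrightarrow> E S (B y) = B (E S y)"
  using spectral_integral_projection[of S "\<lambda>x. x" "B y" y] by (simp add: graph_iff)

text \<open>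
  On the range of the projection onto \<open>t < 1/N\<close> the operator \<open>B\<close> would have to exceed its bound \<open>N\<close>.
\<close>

lemma projection_below: "E {..<1 / N} y = 0"
proof (rule injective)
  define v where "v = E {..<1 / N} y"
  have Bv: "E {..<1 / N} (B v) = B v"
    by (simp add: projection_commute v_def Int)
  then have "E (- {..<1 / N}) (B v) = 0"
    using E_compl(1)[of "{..<1 / N}" "B v"] by simp
  then have "- {..<1 / N} \<in> null_sets (scalar_measure E (B v))"
    by (simp add: null_sets_def emeasure_scalar_measure)
  then have below: "AE t in scalar_measure E (B v). t < 1 / N"
    by (rule eventually_mono[OF AE_not_in]) simp
  interpret finite_measure "scalar_measure E (B v)" by (rule finite_scalar_measure)
  have int: "integrable (scalar_measure E (B v)) (\<lambda>t. t)"
    by (rule square_domain_integrable[OF _ range_square_domain]) simp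
  have total: "measure (scalar_measure E (B v)) UNIV = (norm (B v))\<^sup>2"
    by (simp add: measure_scalar_measure)
  \<comment> \<open>By \<open>norm_bound\<close> this is at least \<open>|B v|^2 / N\<close>,
    whereas \<open>t < 1 / N\<close> almost everywhere; only the zero measure allows both.\<close>
  have "(\<integral>t. t \<partial>scalar_measure E (B v)) = v \<bullet> B v"
    by (rule spectral_integral_inner_self[symmetric]) (simp_all add: graph_iff)
  then have "(\<integral>t. 1 / N - t \<partial>scalar_measure E (B v)) = (norm (B v))\<^sup>2 / N - B v \<bullet> v"
    using int total by (simp add: inner_commute)
  also have "\<dots> \<le> 0"
    using norm_bound[of v] N_pos by (simp add: field_simps)
  finally have "(\<integral>t. 1 / N - t \<partial>scalar_measure E (B v)) \<le> 0" .
  moreover have "0 \<le> (\<integral>t. 1 / N - t \<partial>scalar_measure E (B v))"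
    by (rule integral_nonneg_AE, rule eventually_mono[OF below]) simp
  ultimately have "(\<integral>t. 1 / N - t \<partial>scalar_measure E (B v)) = 0"
    by simp
  then have "AE t in scalar_measure E (B v). 1 / N - t = 0"
    using int below by (subst (asm) integral_nonneg_eq_0_iff_AE) (auto elim: eventually_mono)
  with below have "AE t in scalar_measure E (B v). False"
    by eventually_elim simp
  then have "emeasure (scalar_measure E (B v)) (space (scalar_measure E (B v))) = 0"
    by (simp add: AE_iff_null null_sets_def)
  then show "B (E {..<1 / N} y) = 0"
    by (simp add: emeasure_scalar_measure v_def)
qed

lemma AE_scalar_measure_ge: "AE t in scalar_measure E y. 1 / N \<le> t"
proof -
  have "{..<1 / N} \<in> null_sets (scalar_measure E y)"
    by (simp add: null_sets_def emeasure_scalar_measure projection_below)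
  then show ?thesis
    by (rule eventually_mono[OF AE_not_in]) simp
qed

text \<open>On \<open>S\<close> the measure of \<open>y\<close> is \<open>t\<close> times the
  polarised measure of \<open>B y\<close> and \<open>y\<close>: this is \<open>y = T (B y)\<close>
  tested with projections of \<open>y\<close>. Boundedness of \<open>t\<close> on \<open>S\<close>
  keeps the test vectors in the domain of \<open>T\<close>.\<close>

lemma integral_mult_identity:
  assumes S[measurable]: "S \<in> sets borel" and bb: "(\<lambda>t. indicator S t * t) \<in> bounded_borel"
    and \<phi>: "\<phi> \<in> bounded_borel"
  shows "(\<integral>t. \<phi> t * indicator S t \<partial>scalar_measure E y) =
    (1/4) * ((\<integral>t. \<phi> t * (indicator S t * t) \<partial>scalar_measure E (B y + y)) -
      (\<integral>t. \<phi> t * (indicator S t * t) \<partial>scalar_measure E (B y - y)))"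
proof (rule normal_functional_eq_if_indicator[OF _ _ _ \<phi>])
  have normal: "normal_functional (\<lambda>\<phi>. \<integral>t. \<phi> t * g t \<partial>scalar_measure E h)" if "g \<in> bounded_borel" for h g
    using normal_functional_mult[OF normal_functional_integral[OF finite_scalar_measure] that] by simp
  show "normal_functional (\<lambda>\<phi>. \<integral>t. \<phi> t * indicator S t \<partial>scalar_measure E y)"
    by (rule normal) simp
  show "normal_functional (\<lambda>\<phi>. (1/4) * ((\<integral>t. \<phi> t * (indicator S t * t) \<partial>scalar_measure E (B y + y)) -
      (\<integral>t. \<phi> t * (indicator S t * t) \<partial>scalar_measure E (B y - y))))"
    by (intro normal_functional_cmult normal_functional_diff normal bb)
  fix R :: "real set" assume R: "R \<in> sets borel"
  define W where "W = R \<inter> S"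
  have W[measurable]: "W \<in> sets borel" using R by (simp add: W_def)
  have ind: "indicator R t * (indicator S t * x) = indicator W t * (x::real)" for t x
    by (simp add: W_def indicator_inter_arith)
  have "(\<lambda>t. indicator W t * t) \<in> bounded_borel"
    using bounded_borel_mult[OF bounded_borel_indicator[OF R] bb] by (simp add: ind)
  then have dom: "E W y \<in> square_domain (\<lambda>x. x)"
    by (intro square_domain_bounded_projection) simp_all
  have "(\<integral>t. indicator R t * indicator S t \<partial>scalar_measure E y) = y \<bullet> E W y"
    by (simp add: indicator_inter_arith[symmetric] W_def[symmetric] measure_scalar_measure inner_eq_norm)
  also have "\<dots> = ((\<integral>x. x \<partial>scalar_measure E (B y + E W y)) - (\<integral>x. x \<partial>scalar_measure E (B y - E W y))) / 4"
    by (rule inner_square_domain[OF dom])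
  finally show "(\<integral>t. indicator R t * indicator S t \<partial>scalar_measure E y) =
      (1/4) * ((\<integral>t. indicator R t * (indicator S t * t) \<partial>scalar_measure E (B y + y)) -
        (\<integral>t. indicator R t * (indicator S t * t) \<partial>scalar_measure E (B y - y)))"
    by (simp add: ind integral_polar_projection[OF W _ range_square_domain dom])
qed

text \<open>For \<open>1 / t\<close> on bounded pieces \<open>S n\<close> of
  \<open>[1/N, \<infinity>)\<close> the factor \<open>t\<close> of the previous lemma cancels. What
  remains is the polarised mass of \<open>S n\<close> at \<open>B y\<close> and \<open>y\<close>,
  which tends to \<open>(B y, y)\<close>.\<close>

lemma
  shows integrable_inverse: "integrable (scalar_measure E y) inverse"
    and integral_inverse: "(\<integral>t. inverse t \<partial>scalar_measure E y) = B y \<bullet> y"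
proof -
  define c where "c = 1 / N"
  have c: "0 < c" using N_pos by (simp add: c_def)
  define S where "S n = {c..c + real n}" for n
  have S[measurable]: "S n \<in> sets borel" for n by (simp add: S_def)
  define r where "r t = indicator {c..} t * inverse t" for t
  have r[measurable]: "r \<in> borel_measurable borel" unfolding r_def by measurable
  have r_bound: "\<bar>r t\<bar> \<le> inverse c" for t
    using c by (auto simp: r_def indicator_def intro: le_imp_inverse_le)
  then have r_bb: "r \<in> bounded_borel" by (intro bounded_borelI[OF r])
  have ind_lim: "(\<lambda>n. indicator (S n) t) \<longlonglongrightarrow> (indicator {c..} t :: real)" for t
  proof -
    obtain n0 where "t - c \<le> real n0" using real_arch_simple by blast
    then have "eventually (\<lambda>n. indicator (S n) t = (indicator {c..} t :: real)) sequentially"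
      by (intro eventually_sequentiallyI[of n0]) (auto simp: S_def indicator_def)
    then show ?thesis by (rule tendsto_eventually)
  qed
  have lim1: "bounded_limit (\<lambda>n. indicator (S n)) (indicator {c..})"
    unfolding bounded_limit_def using ind_lim by (auto intro!: exI[of _ 1] simp: indicator_def)
  have "bounded_limit (\<lambda>n t. indicator (S n) t * r t) (\<lambda>t. indicator {c..} t * r t)"
    by (rule bounded_limit_mult[OF lim1 r_bb])
  moreover have "(\<lambda>t. indicator {c..} t * r t) = r"
    by (auto simp: r_def indicator_def)
  ultimately have lim2: "bounded_limit (\<lambda>n t. r t * indicator (S n) t) r"
    by (simp add: mult.commute)
  have cut: "(\<integral>t. r t * indicator (S n) t \<partial>scalar_measure E y) =
      (1/4) * ((\<integral>t. indicator (S n) t \<partial>scalar_measure E (B y + y)) -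
        (\<integral>t. indicator (S n) t \<partial>scalar_measure E (B y - y)))" for n
  proof -
    have "(\<lambda>t. indicator (S n) t * t) \<in> bounded_borel"
      using c by (intro bounded_borelI[where K = "c + real n"]) (auto simp: S_def indicator_def)
    moreover have "(\<lambda>t. r t * (indicator (S n) t * t)) = indicator (S n)"
      using c by (auto simp: r_def S_def indicator_def)
    ultimately show ?thesis
      using integral_mult_identity[of "S n" r y] r_bb by simp
  qed
  note normal = normal_functional_integral[OF finite_scalar_measure sets_scalar_measure]
  have "(\<lambda>n. (1/4) * ((\<integral>t. indicator (S n) t \<partial>scalar_measure E (B y + y)) -
        (\<integral>t. (indicator (S n) t :: real) \<partial>scalar_measure E (B y - y)))) \<longlonglongrightarrow>
      (1/4) * ((\<integral>t. indicator {c..} t \<partial>scalar_measure E (B y + y)) -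
        (\<integral>t. indicator {c..} t \<partial>scalar_measure E (B y - y)))"
    by (intro tendsto_intros normal_functionalD(3)[OF normal] lim1)
  then have lim: "(\<integral>t. r t \<partial>scalar_measure E y) =
      (1/4) * ((\<integral>t. indicator {c..} t \<partial>scalar_measure E (B y + y)) -
        (\<integral>t. indicator {c..} t \<partial>scalar_measure E (B y - y)))"
    unfolding cut[symmetric] using normal_functionalD(3)[OF normal lim2] LIMSEQ_unique by blast
  have total: "(\<integral>t. indicator {c..} t \<partial>scalar_measure E h) = (norm h)\<^sup>2" for h
  proof -
    have "(\<integral>t. indicator {c..} t \<partial>scalar_measure E h) = (\<integral>t. 1 \<partial>scalar_measure E h)"
      using AE_scalar_measure_ge[of h] by (intro integral_cong_AE) (auto simp: c_def elim!: eventually_mono)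
    then show ?thesis by (rule trans) (simp add: measure_scalar_measure)
  qed
  have int: "(\<integral>t. r t \<partial>scalar_measure E y) = B y \<bullet> y"
    unfolding lim total power2_norm_eq_inner
    by (simp add: inner_add_left inner_add_right inner_diff_left inner_diff_right inner_commute[of y "B y"])
  have AE: "AE t in scalar_measure E y. r t = inverse t"
    using AE_scalar_measure_ge[of y] by eventually_elim (simp add: r_def c_def)
  then show "(\<integral>t. inverse t \<partial>scalar_measure E y) = B y \<bullet> y"
    using int integral_cong_AE[OF _ _ AE] by simp
  have "integrable (scalar_measure E y) r"
    by (intro integrable_bounded_borel finite_scalar_measure r_bb) simp
  then show "integrable (scalar_measure E y) inverse"
    using AE by (subst (asm) integrable_cong_AE) auto
qed

text \<open>
  Jensen's inequality for the probability measure \<open>dP = inverse t / (B h, h) d\<mu>\<^sub>h\<close> and the function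
  \<open>t \<mapsto> \<phi> t * t\<close>, whose \<open>P\<close>-integral is \<open>\<integral>\<phi> d\<mu>\<^sub>h / (B h, h)\<close>, while that of \<open>t\<close> is \<open>\<parallel>h\<parallel>\<^sup>2 / (B h, h)\<close>.
\<close>

lemma interpolation_inequality:
  assumes conc: "concave_on {0<..} \<Psi>"
    and ge: "\<And>t. 1 / N \<le> t \<Longrightarrow> 0 < \<phi> t \<and> t \<le> \<Psi> (\<phi> t * t)"
    and int: "integrable (scalar_measure E h) \<phi>"
    and B_pos: "0 < B h \<bullet> h" and Q_pos: "0 < (\<integral>t. \<phi> t \<partial>scalar_measure E h)"
  shows "(norm h)\<^sup>2 \<le> (B h \<bullet> h) * \<Psi> ((\<integral>t. \<phi> t \<partial>scalar_measure E h) / (B h \<bullet> h))"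
proof -
  define Q where "Q = (\<integral>t. \<phi> t \<partial>scalar_measure E h)"
  define b where "b = B h \<bullet> h"
  define p where "p = Q / b"
  have p: "0 < p" using B_pos Q_pos by (simp add: p_def Q_def b_def)
  \<comment> \<open>A supergradient of \<open>\<Psi>\<close> at \<open>p\<close>: minus the infimum
    of the right difference quotients of the convex function \<open>- \<Psi>\<close>.\<close>
  define s where "s = - Inf ((\<lambda>t. (- \<Psi> p - - \<Psi> t) / (p - t)) ` ({p<..} \<inter> {0<..}))"
  have tangent: "\<Psi> x \<le> \<Psi> p + s * (x - p)" if "0 < x" for x
    using convex_le_Inf_differential[of "{0<..}" "\<lambda>x. - \<Psi> x" p x] conc p that
    by (simp add: concave_on_def s_def interior_open)
  \<comment> \<open>The tangent inequality at \<open>\<phi> t * t\<close>, combined with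
    \<open>ge\<close> and divided by \<open>t\<close>.\<close>
  have "1 \<le> (\<Psi> p - s * p) * inverse t + s * \<phi> t" if t: "1 / N \<le> t" for t
  proof -
    have t0: "0 < t" using t N_pos by (meson divide_pos_pos less_le_trans zero_less_one)
    have "t \<le> \<Psi> p + s * (\<phi> t * t - p)"
      using ge[OF t] tangent[of "\<phi> t * t"] t0 by fastforce
    then have "t * inverse t \<le> (\<Psi> p + s * (\<phi> t * t - p)) * inverse t"
      using t0 by (intro mult_right_mono) auto
    then show ?thesis using t0 by (simp add: field_simps)
  qed
  then have "AE t in scalar_measure E h. 1 \<le> (\<Psi> p - s * p) * inverse t + s * \<phi> t"
    using AE_scalar_measure_ge[of h] by (auto elim: eventually_mono)
  moreover interpret finite_measure "scalar_measure E h" by (rule finite_scalar_measure)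
  have "integrable (scalar_measure E h) (\<lambda>t. (\<Psi> p - s * p) * inverse t + s * \<phi> t)"
    using int integrable_inverse[of h] by (intro Bochner_Integration.integrable_add integrable_mult_right)
  ultimately have "(\<integral>t. 1 \<partial>scalar_measure E h) \<le> (\<integral>t. (\<Psi> p - s * p) * inverse t + s * \<phi> t \<partial>scalar_measure E h)"
    by (intro integral_mono_AE) auto
  also have "\<dots> = (\<Psi> p - s * p) * b + s * Q"
    using int integrable_inverse[of h] by (simp add: integral_inverse Q_def b_def)
  \<comment> \<open>The slope terms cancel because \<open>p = Q / b\<close>.\<close>
  also have "\<dots> = b * \<Psi> p"
    using B_pos by (simp add: p_def b_def[symmetric] algebra_simps)
  finally show ?thesis
    by (simp add: measure_scalar_measure p_def Q_def b_def)
qed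

end

section \<open>The Gram operator\<close>

lemma gram_inner:
  fixes A :: "'a::{real_inner, complete_space} \<Rightarrow> 'b::real_inner"
  assumes "bounded_linear A"
  shows "gram A x \<bullet> y = A x \<bullet> A y"
  using adjoint_inner[OF assms, of y "A x"] by (simp add: gram_def inner_commute)

lemma bounded_linear_gram:
  fixes A :: "'a::{real_inner, complete_space} \<Rightarrow> 'b::real_inner"
  assumes A: "bounded_linear A"
  shows "bounded_linear (gram A)"
proof -
  interpret A: bounded_linear A by fact
  obtain K where K: "0 \<le> K" "\<And>x. norm (A x) \<le> norm x * K"
    using A.nonneg_bounded by blast
  have eqI: "u = v" if "\<And>y. u \<bullet> y = v \<bullet> y" for u v :: 'a
    using that vector_eq_rdot[of u v] by blast
  show ?thesis
  proof (rule bounded_linear_intro[where K = "K * K"])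
    show "gram A (x + y) = gram A x + gram A y" for x y
      by (rule eqI) (simp add: gram_inner[OF A] A.add inner_add_left)
    show "gram A (c *\<^sub>R x) = c *\<^sub>R gram A x" for c x
      by (rule eqI) (simp add: gram_inner[OF A] A.scaleR)
    show "norm (gram A x) \<le> norm x * (K * K)" for x
    proof -
      have "norm (gram A x) * norm (gram A x) = A x \<bullet> A (gram A x)"
        by (simp add: gram_inner[OF A, symmetric] power2_norm_eq_inner flip: power2_eq_square)
      also have "\<dots> \<le> norm (A x) * norm (A (gram A x))"
        by (rule norm_cauchy_schwarz)
      also have "\<dots> \<le> (norm x * K) * (norm (gram A x) * K)"
        by (intro mult_mono K) (simp_all add: K)
      finally have "norm (gram A x) * norm (gram A x) \<le> (norm x * (K * K)) * norm (gram A x)"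
        by (simp add: mult_ac)
      then show ?thesis
        using K(1) by (cases "norm (gram A x) = 0") (auto simp: mult_le_cancel_right)
    qed
  qed
qed

text \<open>With \<open>u = gram A x\<close>, Cauchy-Schwarz for \<open>A x\<close> and
  \<open>A u\<close> gives \<open>|u|^4 \<le> (u, x) (gram A u, u)\<close>; bound the last factor by
  the operator norm and cancel \<open>|u|^2\<close>.\<close>

lemma norm_gram_squared_le:
  fixes A :: "'a::{real_inner, complete_space} \<Rightarrow> 'b::real_inner"
  assumes A: "bounded_linear A"
  shows "(norm (gram A x))\<^sup>2 \<le> onorm (gram A) * (gram A x \<bullet> x)"
proof (cases "gram A x = 0")
  case False
  define u where "u = gram A x"
  have "((norm u)\<^sup>2)\<^sup>2 = (A x \<bullet> A u)\<^sup>2"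
    by (simp add: u_def gram_inner[OF A, symmetric] power2_norm_eq_inner)
  also have "\<dots> \<le> (A x \<bullet> A x) * (A u \<bullet> A u)"
    by (rule Cauchy_Schwarz_ineq)
  also have "\<dots> = (u \<bullet> x) * (gram A u \<bullet> u)"
    by (simp add: u_def gram_inner[OF A])
  also have "\<dots> \<le> (u \<bullet> x) * (onorm (gram A) * (norm u)\<^sup>2)"
  proof (rule mult_left_mono)
    have "gram A u \<bullet> u \<le> norm (gram A u) * norm u"
      by (rule norm_cauchy_schwarz)
    also have "\<dots> \<le> (onorm (gram A) * norm u) * norm u"
      by (intro mult_right_mono onorm[OF bounded_linear_gram[OF A]]) simp
    finally show "gram A u \<bullet> u \<le> onorm (gram A) * (norm u)\<^sup>2"
      by (simp add: power2_eq_square mult.assoc)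
    show "0 \<le> u \<bullet> x"
      by (simp add: u_def gram_inner[OF A])
  qed
  finally have "(norm u)\<^sup>2 * (norm u)\<^sup>2 \<le> (onorm (gram A) * (u \<bullet> x)) * (norm u)\<^sup>2"
    by (simp add: power2_eq_square mult_ac)
  then have "(norm u)\<^sup>2 \<le> onorm (gram A) * (u \<bullet> x)"
    by (rule mult_right_le_imp_le) (use False in \<open>simp add: u_def\<close>)
  then show ?thesis
    by (simp add: u_def)
qed simp

text \<open>\<open>proj\<close> witnesses that the choice in \<open>spectral_measure\<close> meets
  its specification; the graph identity is then read off for the chosen resolution.\<close>

lemma spectral_measure_gram_inverse:
  fixes A :: "'a::{real_inner, complete_space} \<Rightarrow> 'b::real_inner"
  assumes A: "bounded_linear A" and "inj A" and pos: "0 < onorm (gram A)"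
  shows "inverse_resolution (spectral_measure (gram_inverse A)) (gram A) (onorm (gram A))"
proof -
  interpret A: bounded_linear A by fact
  have inj: "x = 0" if "gram A x = 0" for x
  proof -
    have "A x \<bullet> A x = 0"
      using gram_inner[OF A, of x x] that by simp
    then have "A x = A 0" by (simp add: A.zero)
    then show ?thesis using \<open>inj A\<close> by (rule injD[rotated])
  qed
  have positive: "positive_operator (gram A) (onorm (gram A))"
  proof (rule positive_operator.intro)
    show "bounded_linear (gram A)" by (rule bounded_linear_gram[OF A])
    show "gram A x \<bullet> y = x \<bullet> gram A y" for x y
      by (metis gram_inner[OF A] inner_commute)
    show "0 \<le> gram A x \<bullet> x" for x
      by (simp add: gram_inner[OF A])
    show "gram A x \<bullet> x \<le> onorm (gram A) * (x \<bullet> x)" for x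
    proof -
      have "gram A x \<bullet> x \<le> norm (gram A x) * norm x"
        by (rule norm_cauchy_schwarz)
      also have "\<dots> \<le> (onorm (gram A) * norm x) * norm x"
        by (intro mult_right_mono onorm[OF bounded_linear_gram[OF A]]) simp
      finally show ?thesis
        by (simp add: mult.assoc norm_eq_sqrt_inner)
    qed
  qed (rule pos)
  interpret injective_positive_operator "gram A" "onorm (gram A)"
    by (rule injective_positive_operator.intro[OF positive injective_positive_operator_axioms.intro[OF inj]])
  define E where "E = spectral_measure (gram_inverse A)"
  have graph: "gram_inverse A = {(gram A x, x) | x. True}"
    by (simp add: gram_inverse_def)
  have "\<exists>E. projection_valued_measure E \<and> gram_inverse A = spectral_integral E (\<lambda>x. x)"
    using projection_valued_measure_proj inverse_eq_spectral_integral unfolding graph by blast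
  then have "projection_valued_measure E \<and> gram_inverse A = spectral_integral E (\<lambda>x. x)"
    unfolding E_def spectral_measure_def by (rule someI_ex)
  then show ?thesis
    unfolding E_def[symmetric] inverse_resolution_def inverse_resolution_axioms_def
      spectral_projections_def graph[symmetric]
    using pos inj norm_gram_squared_le[OF A] by blast
qed

section \<open>The interpolation inequality\<close>

text \<open>Puts the difference of two elements of the scale into the scale, so that its norm is
  taken along an actual representing sequence.\<close>

lemma form_norm_diff_represents:
  assumes diff: "\<And>x y. x \<in> Domain (spectral_calculus T \<nu>) \<Longrightarrow> y \<in> Domain (spectral_calculus T \<nu>) \<Longrightarrow>
      x - y \<in> Domain (spectral_calculus T \<nu>)"
    and tri: "\<And>x y. x \<in> Domain (spectral_calculus T \<nu>) \<Longrightarrow> y \<in> Domain (spectral_calculus T \<nu>) \<Longrightarrow>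
      form_norm T \<nu> (x - y) \<le> form_norm T \<nu> x + form_norm T \<nu> y"
    and a: "represents T \<nu> a x" and b: "represents T \<nu> b y"
  shows "represents T \<nu> (\<lambda>n. a n - b n) (x - y)"
  unfolding represents_def
proof (intro conjI allI impI)
  have dom: "a n \<in> Domain (spectral_calculus T \<nu>)" "b n \<in> Domain (spectral_calculus T \<nu>)" for n
    using a b by (auto simp: represents_def)
  then show "a n - b n \<in> Domain (spectral_calculus T \<nu>)" for n
    by (rule diff)
  show "(\<lambda>n. a n - b n) \<longlonglongrightarrow> x - y"
    using a b by (auto simp: represents_def intro: tendsto_diff)
  fix e :: real assume "0 < e"
  then have "0 < e / 2" by simp
  with a b obtain N1 N2 where
    N1: "\<And>m n. m \<ge> N1 \<Longrightarrow> n \<ge> N1 \<Longrightarrow> form_norm T \<nu> (a m - a n) < e / 2" and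
    N2: "\<And>m n. m \<ge> N2 \<Longrightarrow> n \<ge> N2 \<Longrightarrow> form_norm T \<nu> (b m - b n) < e / 2"
    unfolding represents_def by meson
  show "\<exists>N. \<forall>m\<ge>N. \<forall>n\<ge>N. form_norm T \<nu> (a m - b m - (a n - b n)) < e"
  proof (intro exI allI impI)
    fix m n assume "max N1 N2 \<le> m" "max N1 N2 \<le> n"
    then have "form_norm T \<nu> (a m - a n) < e / 2" "form_norm T \<nu> (b m - b n) < e / 2"
      using N1 N2 by simp_all
    then have "form_norm T \<nu> ((a m - a n) - (b m - b n)) < e"
      using tri[OF diff[OF dom(1) dom(1)] diff[OF dom(2) dom(2)], of m n m n] by simp
    moreover have "a m - b m - (a n - b n) = (a m - a n) - (b m - b n)"
      by simp
    ultimately show "form_norm T \<nu> (a m - b m - (a n - b n)) < e"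
      by (simp only:)
  qed
qed

theorem corollary2p7:
  fixes A :: "'x::{real_inner, polish_space} \<Rightarrow> 'y::{real_inner, polish_space}"
    and chi \<Psi> :: "real \<Rightarrow> real"
    and f f\<^sub>\<alpha> :: 'x and g :: 'y and \<zeta> \<epsilon> :: real
  assumes "infinite_dimensional TYPE('x)" and "infinite_dimensional TYPE('y)"
    and "bounded_linear A" and "inj A" and "\<not> closed (range A)"
    and "index_function chi" and "index_function \<Psi>" and "concave_on {0<..} \<Psi>"
    and "\<forall>t. inverse (onorm (gram A)) \<le> t \<longrightarrow> t \<le> \<Psi> (chi t * t)"
    and "A f = g"
    and "f \<in> hilbert_scale (gram_inverse A) chi"
    and "f\<^sub>\<alpha> \<in> hilbert_scale (gram_inverse A) chi"
    and "scale_norm (gram_inverse A) chi (f\<^sub>\<alpha> - f) = \<zeta>" and "\<zeta> > 0"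
    and "norm (A f\<^sub>\<alpha> - g) = \<epsilon>" and "\<epsilon> > 0"
  shows "norm (f - f\<^sub>\<alpha>) \<le> \<epsilon> * sqrt (\<Psi> (\<zeta>\<^sup>2 / \<epsilon>\<^sup>2))"
proof -
  interpret A: bounded_linear A by fact
  define h where "h = f\<^sub>\<alpha> - f"
  have Ah: "norm (A h) = \<epsilon>"
    using assms(10,15) by (simp add: h_def A.diff)
  have onorm_pos: "0 < onorm (gram A)"
  proof (rule ccontr)
    assume "\<not> 0 < onorm (gram A)"
    then have "onorm (gram A) = 0"
      using onorm_pos_le[OF bounded_linear_gram[OF assms(3)]] by simp
    then have "gram A h = 0"
      using onorm[OF bounded_linear_gram[OF assms(3)], of h] by simp
    then have "A h = 0"
      using gram_inner[OF assms(3), of h h] by simp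
    then show False using Ah \<open>\<epsilon> > 0\<close> by simp
  qed
  define T where "T = gram_inverse A"
  define E where "E = spectral_measure T"
  interpret inverse_resolution E "gram A" "onorm (gram A)"
    unfolding E_def T_def by (rule spectral_measure_gram_inverse[OF assms(3,4) onorm_pos])
  define \<phi> where "\<phi> x = (if x > 0 then chi x else 0)" for x
  define D where "D = Domain (spectral_calculus T chi)"
  have calculus: "spectral_calculus T chi = spectral_integral E \<phi>"
    by (simp add: spectral_calculus_def E_def \<phi>_def[abs_def])
  have chi: "continuous_on {0<..} chi" "\<And>x. 0 < x \<Longrightarrow> 0 < chi x"
    and \<Psi>: "continuous_on {0<..} \<Psi>"
    using assms(6,7) by (auto simp: index_function_def)
  have "\<phi> = (\<lambda>x. indicator {0<..} x *\<^sub>R chi x)"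
    by (auto simp: \<phi>_def indicator_def)
  then have \<phi>[measurable]: "\<phi> \<in> borel_measurable borel"
    using borel_measurable_continuous_on_indicator[OF _ chi(1)] by simp
  have \<phi>_nonneg: "0 \<le> \<phi> x" for x
    using chi(2)[of x] by (auto simp: \<phi>_def)
  have D_square: "x \<in> square_domain \<phi>" if "x \<in> D" for x
    using that by (auto simp: D_def calculus spectral_integral_iff)
  have D_diff: "x - y \<in> D" if "x \<in> D" "y \<in> D" for x y
    using Domain_spectral_integral_diff[OF \<phi> \<phi>_nonneg] that by (simp add: D_def calculus)
  have form: "form_norm T chi x = sqrt (\<integral>t. \<phi> t \<partial>scalar_measure E x)" if "x \<in> D" for x
    using quadratic_form_spectral_integral[OF \<phi>] that by (simp add: D_def calculus form_norm_def)
  have form_minus: "form_norm T chi (x - y) = form_norm T chi (y - x)" if "x \<in> D" "y \<in> D" for x y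
    using that by (simp add: form D_diff scalar_measure_minus[of x y])
  have zero: "0 \<in> D" if "x \<in> D" for x
    using D_diff[OF that that] by simp
  have form_tri: "form_norm T chi (x - y) \<le> form_norm T chi x + form_norm T chi y" if "x \<in> D" "y \<in> D" for x y
  proof -
    have m: "- y \<in> D" "scalar_measure E (- y) = scalar_measure E y"
      using D_diff[OF zero[OF that(2)] that(2)] scalar_measure_minus[of 0 y] by simp_all
    show ?thesis
      using sqrt_integral_triangle[OF \<phi> \<phi>_nonneg D_square[OF that(1)] D_square[OF m(1)]] that
      by (simp add: form D_diff m(2))
  qed
  have form_reverse: "\<bar>form_norm T chi x - form_norm T chi y\<bar> \<le> form_norm T chi (x - y)"
    if "x \<in> D" "y \<in> D" for x y
  proof -
    have "form_norm T chi (u - (u - v)) \<le> form_norm T chi u + form_norm T chi (u - v)" if "u \<in> D" "v \<in> D" for u v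
      by (intro form_tri D_diff that)
    from this[OF that] this[OF that(2,1)] show ?thesis
      using form_minus[OF that] by simp
  qed
  obtain a b where "represents T chi a f\<^sub>\<alpha>" "represents T chi b f"
    using assms(11,12) by (auto simp: hilbert_scale_def T_def)
  then have rep: "represents T chi (\<lambda>n. a n - b n) h"
    unfolding h_def by (intro form_norm_diff_represents) (auto simp: D_def[symmetric] form_tri D_diff)
  \<comment> \<open>The very sequence inside \<open>scale_norm\<close>; \<open>rep\<close>
    guarantees that it represents \<open>h\<close>.\<close>
  define s where "s = (SOME s. represents T chi s h)"
  have "represents T chi s h"
    unfolding s_def using someI_ex[of "\<lambda>s. represents T chi s h"] rep by blast
  then have sD: "\<And>n. s n \<in> D" and s_lim: "s \<longlonglongrightarrow> h"
    and s_Cauchy: "\<And>e. 0 < e \<Longrightarrow> \<exists>N. \<forall>m\<ge>N. \<forall>n\<ge>N. form_norm T chi (s m - s n) < e"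
    by (auto simp: represents_def D_def)
  define q where "q n = form_norm T chi (s n)" for n
  have "Cauchy q"
  proof (rule metric_CauchyI)
    fix e :: real assume "0 < e"
    then obtain N where "\<And>m n. m \<ge> N \<Longrightarrow> n \<ge> N \<Longrightarrow> form_norm T chi (s m - s n) < e"
      using s_Cauchy by blast
    then have "dist (q m) (q n) < e" if "m \<ge> N" "n \<ge> N" for m n
      using form_reverse[OF sD sD, of m n] that by (fastforce simp: q_def dist_real_def)
    then show "\<exists>N. \<forall>m\<ge>N. \<forall>n\<ge>N. dist (q m) (q n) < e" by blast
  qed
  \<comment> \<open>Since \<open>q\<close> is Cauchy, the \<open>lim\<close> in
    \<open>scale_norm\<close> is a genuine limit.\<close>
  then have q_lim: "q \<longlonglongrightarrow> \<zeta>"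
    using assms(13) by (simp add: scale_norm_def T_def[symmetric] h_def[symmetric] s_def[symmetric]
        q_def[symmetric] Cauchy_convergent_iff convergent_LIMSEQ_iff)
  have A_lim: "(\<lambda>n. norm (A (s n))) \<longlonglongrightarrow> \<epsilon>"
    using tendsto_norm[OF A.tendsto[OF s_lim]] by (simp add: Ah)
  have ineq: "(norm (s n))\<^sup>2 \<le> (norm (A (s n)))\<^sup>2 * \<Psi> ((q n)\<^sup>2 / (norm (A (s n)))\<^sup>2)"
    if "0 < q n" "0 < norm (A (s n))" for n
  proof -
    have q2: "(q n)\<^sup>2 = (\<integral>t. \<phi> t \<partial>scalar_measure E (s n))"
      by (simp add: q_def form[OF sD] \<phi>_nonneg)
    have A2: "(norm (A (s n)))\<^sup>2 = gram A (s n) \<bullet> s n"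
      by (simp add: gram_inner[OF assms(3)] power2_norm_eq_inner)
    \<comment> \<open>The hypothesis on \<open>\<Psi>\<close> and \<open>chi\<close> covers exactly
      the half-line on which the scalar measures live.\<close>
    have "0 < \<phi> t \<and> t \<le> \<Psi> (\<phi> t * t)" if "1 / onorm (gram A) \<le> t" for t
    proof -
      have "0 < t" using that onorm_pos by (meson divide_pos_pos less_le_trans zero_less_one)
      then show ?thesis
        using assms(9) chi(2) that by (simp add: \<phi>_def inverse_eq_divide)
    qed
    then show ?thesis
      using interpolation_inequality[OF assms(8), of \<phi> "s n"] that
        square_domain_integrable[OF \<phi> D_square[OF sD[of n]]]
      unfolding q2[symmetric] A2[symmetric] by simp
  qed
  have ev: "eventually (\<lambda>n. 0 < q n) sequentially" "eventually (\<lambda>n. 0 < norm (A (s n))) sequentially"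
    using order_tendstoD(1)[OF q_lim \<open>\<zeta> > 0\<close>] order_tendstoD(1)[OF A_lim \<open>\<epsilon> > 0\<close>] by simp_all
  \<comment> \<open>The limiting argument is positive, hence inside the open half-line where
    \<open>\<Psi>\<close> is continuous.\<close>
  have "isCont \<Psi> (\<zeta>\<^sup>2 / \<epsilon>\<^sup>2)"
    using \<Psi> \<open>\<zeta> > 0\<close> \<open>\<epsilon> > 0\<close> by (simp add: continuous_on_eq_continuous_at)
  then have "(\<lambda>n. (norm (A (s n)))\<^sup>2 * \<Psi> ((q n)\<^sup>2 / (norm (A (s n)))\<^sup>2)) \<longlonglongrightarrow> \<epsilon>\<^sup>2 * \<Psi> (\<zeta>\<^sup>2 / \<epsilon>\<^sup>2)"
    using \<open>\<epsilon> > 0\<close> by (intro tendsto_intros isCont_tendsto_compose[of _ \<Psi>] A_lim q_lim) simp_all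
  moreover have "(\<lambda>n. (norm (s n))\<^sup>2) \<longlonglongrightarrow> (norm h)\<^sup>2"
    by (intro tendsto_intros s_lim)
  moreover have "eventually (\<lambda>n. (norm (s n))\<^sup>2 \<le> (norm (A (s n)))\<^sup>2 * \<Psi> ((q n)\<^sup>2 / (norm (A (s n)))\<^sup>2)) sequentially"
    using ev by eventually_elim (rule ineq)
  ultimately have "(norm h)\<^sup>2 \<le> \<epsilon>\<^sup>2 * \<Psi> (\<zeta>\<^sup>2 / \<epsilon>\<^sup>2)"
    by (intro tendsto_le[OF sequentially_bot])
  then have "norm h \<le> sqrt (\<epsilon>\<^sup>2 * \<Psi> (\<zeta>\<^sup>2 / \<epsilon>\<^sup>2))"
    by (rule real_le_rsqrt)
  also have "\<dots> = \<epsilon> * sqrt (\<Psi> (\<zeta>\<^sup>2 / \<epsilon>\<^sup>2))"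
    using \<open>\<epsilon> > 0\<close> by (simp add: real_sqrt_mult)
  finally show ?thesis
    by (simp add: h_def norm_minus_commute)
qed

end
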